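(* Let $L\subseteq\mathbb{R}^n$ be a linear subspace of dimension $m$, let $Q\in\mathbb{R}^{n\times m}$ have columns forming an orthonormal basis of $L$, and let $P=QQ^T$ be the orthogonal projection onto $L$. The following hold for the Limited Support Perceptron Scheme (LSP) and the Limited Support Von Neumann Scheme (LSVN): 1. For all $t\ge 1$ such that LSP or LSVN have not halted, $\|z_t\|^2\le\frac1t$. 2. The stopping condition, $Px_t>0$ or $\|(Px_t)^+\|\le\frac{\|x_t\|_\infty}{3\sqrt n}$, occurs in at most $9(m+1)^2n$ iterations. 3. LSP and LSVN require $O(m^4n)$ arithmetic operations.
   Context: $\|\cdot\|$ is the Euclidean norm; $(v)^+$ is the componentwise positive part of $v$; $v>0$ means all entries are positive; $[n]=\{1,\dots,n\}$; $e_i$ is the $i$-th unit vector; $\Delta_{n-1}:=\{x\in\mathbb{R}^n:\|x\|_1=1,\ x\ge0\}$. For an ordered set of indices $B=[B(1),\dots,B(k)]\subseteq[n]$, a matrix $A\in\mathbb{R}^{m\times n}$ and $x\in\mathbb{R}^n$: $A_i$ is the $i$-th column of $A$, $A_B=[A_{B(1)}\cdots A_{B(k)}]$, $x_B=(x_{B(1)},\dots,x_{B(k)})$; $\tilde A\in\mathbb{R}^{(m+1)\times n}$ is $A$ with a row of ones added on top, with $\tilde A_B,\tilde A_j$ defined accordingly. For full column rank $M$, $M^\dagger=(M^TM)^{-1}M^T$. Below $A=Q^T$, with columns $q_1,\dots,q_n\in\mathbb{R}^m$; write $\tilde q_i=(1,q_i)\in\mathbb{R}^{m+1}$ for the columns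 of $\tilde A$ and $\tilde Q_B^\dagger$ for $\tilde A_B^\dagger$. Procedure mIRR (modified incremental representation reduction). Input: $B=[B(1),\dots,B(k)]$ such that $A_B$ has affinely independent columns, $\tilde A_B^\dagger$, $j\notin B$, and $x\in\Delta_{n-1}$ vanishing outside $B':=[B(1),\dots,B(k),j]$. (1) Compute $u'=\tilde A_B^\dagger\tilde A_j\in\mathbb{R}^k$, $u=(u',-1)\in\mathbb{R}^{k+1}$. If $\tilde A_Bu'\neq\tilde A_j$, output $x^+=x$, $B^+=B'$, $$\tilde A_{B^+}^\dagger=\begin{bmatrix}\tilde A_B^\dagger\\0\end{bmatrix}-\begin{bmatrix}\tilde A_B^\dagger\tilde A_j\\-1\end{bmatrix}\frac{\tilde A_j^T(I-\tilde A_B\tilde A_B^\dagger)}{\tilde A_j^T(I-\tilde A_B\tilde A_B^\dagger)\tilde A_j}$$ and stop. (2) Otherwise let $\theta^*=\max_{i:u_i<0}x_{B'(i)}/u_i$, let $i^*$ be the smallest index $i$ with $u_i<0$ attaining it, and set $x^+_{B'}=x_{B'}+\theta^*u$, $x^+_i=0$ for $i\notin B'$. If $B'(i^* )=j$, output $x^+$, $B^+=B$, $\tilde A_{B^+}^\dagger=\tilde A_B^\dagger$ and stop. (3) Otherwise let $B^+$ be $B$ with its $i^*$-th entry replaced by $j$; form the matrix $[\tilde A_B^\dagger\mid u']$ and add to each row a multiple of the $i^*$-th row to make the last column equal to $e_{i^*}$; output $x^+$, $B^+$, and as $\tilde A_{B^+}^\dagger$ the resulting matrix with its last column removed. Limited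 Support Scheme. Initialize $x_0=e_1$, $z_0=Q^Tx_0=q_1$, $B_0=[1]$, $\tilde Q_{B_0}^\dagger=\tilde q_1^T/\|\tilde q_1\|^2$, $t=0$. While the stopping condition "$Px_t>0$ or $\|(Px_t)^+\|\le\frac{1}{3\sqrt n}\|x_t\|_\infty$" fails, perform the iteration: let $j=\operatorname{argmin}_{i\in[n]}\langle q_i,z_t\rangle$; $x'_{t+1}=x_t+\theta_t(e_j-x_t)$; $z_{t+1}=Q^Tx'_{t+1}$; if $j\notin B_t$, let $(x_{t+1},B_{t+1},\tilde Q_{B_{t+1}}^\dagger)$ be the output of mIRR (with $A=Q^T$) on input $B_t$, $\tilde Q_{B_t}^\dagger$, $j$, $x'_{t+1}$; otherwise $x_{t+1}=x'_{t+1}$, $B_{t+1}=B_t$, $\tilde Q_{B_{t+1}}^\dagger=\tilde Q_{B_t}^\dagger$; then increase $t$ by one. The scheme halts when the stopping condition holds. LSP is this scheme with $\theta_t=\frac{1}{t+1}$. LSVN is this scheme with $\theta_t$ determined by an exact line search, i.e. $\theta_t$ minimizes $\|P(x_t+\theta(e_j-x_t))\|^2$ over $\theta\in[0,1]$.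
   Formalization: In mIRR step (2) the update is x − θ*u instead of x + θ*u; in item 3 (for m ≥ 1) the O(m⁴n) bound excludes the choice of j and the stopping test, and the count including them is bounded by O(m³n²), since O(m⁴n) fails for it. *)

theory Defs
  imports "Jordan_Normal_Form.Matrix" "Jordan_Normal_Form.VS_Connect"
begin

text \<open>Dimensions are natural numbers and vectors and matrices are those of
  \<^theory>\<open>Jordan_Normal_Form.Matrix\<close>, so that constants hidden in asymptotic bounds can be
  required to be uniform in the dimensions.  Indices start at 0: the index set is
  \<open>{0..<n}\<close>, and the first unit vector is \<open>unit_vec n 0\<close>.\<close>

definition euclid_norm :: "real vec \<Rightarrow> real" where
  "euclid_norm v = sqrt (v \<bullet> v)"

definition inf_norm :: "real vec \<Rightarrow> real" where
  "inf_norm v = Max ((\<lambda>i. \<bar>v $ i\<bar>) ` {..<dim_vec v})"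

definition pos_part :: "real vec \<Rightarrow> real vec" where
  "pos_part v = map_vec (\<lambda>a. max a 0) v"

definition orthonormal_basis_matrix :: "nat \<Rightarrow> nat \<Rightarrow> real vec set \<Rightarrow> real mat \<Rightarrow> bool" where
  "orthonormal_basis_matrix n m L Q \<longleftrightarrow>
     (let V = module_vec TYPE(real) n; VL = V\<lparr>carrier := L\<rparr> in
      VectorSpace.subspace class_ring L V \<and>
      vectorspace.dim class_ring VL = m \<and>
      Q \<in> carrier_mat n m \<and>
      (\<forall>i<m. \<forall>j<m. col Q i \<bullet> col Q j = of_bool (i = j)) \<and>
      vectorspace.basis class_ring VL (set (cols Q)))"

definition proj_mat :: "real mat \<Rightarrow> real mat" where
  "proj_mat Q = Q * transpose_mat Q"

definition tilde_mat :: "real mat \<Rightarrow> real mat" where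
  "tilde_mat A = mat (dim_row A + 1) (dim_col A) (\<lambda>(i, j). if i = 0 then 1 else A $$ (i - 1, j))"

definition sub_cols :: "real mat \<Rightarrow> nat list \<Rightarrow> real mat" where
  "sub_cols A B = mat_of_cols (dim_row A) (map (col A) B)"

definition sub_vec :: "real vec \<Rightarrow> nat list \<Rightarrow> real vec" where
  "sub_vec x B = vec_of_list (map (\<lambda>i. x $ i) B)"

text \<open>The vector of dimension \<open>n\<close> with subvector \<open>v\<close> at the positions \<open>B\<close> (which are distinct,
  so each sum has at most one term) and with zeros elsewhere.\<close>

definition scatter :: "nat \<Rightarrow> nat list \<Rightarrow> real vec \<Rightarrow> real vec" where
  "scatter n B v = vec n (\<lambda>l. \<Sum>i | i < length B \<and> B ! i = l. v $ i)"

text \<open>\<open>M\<close> is the matrix carried along as pseudoinverse of \<open>sub_cols (tilde_mat A) B\<close>.\<close>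

definition mirr_coeffs :: "real mat \<Rightarrow> nat list \<Rightarrow> real mat \<Rightarrow> nat \<Rightarrow> real vec" where
  "mirr_coeffs A B M j = M *\<^sub>v col (tilde_mat A) j"

definition mirr_independent :: "real mat \<Rightarrow> nat list \<Rightarrow> real mat \<Rightarrow> nat \<Rightarrow> bool" where
  "mirr_independent A B M j \<longleftrightarrow>
     sub_cols (tilde_mat A) B *\<^sub>v mirr_coeffs A B M j \<noteq> col (tilde_mat A) j"

definition mirr_theta :: "real vec \<Rightarrow> real vec \<Rightarrow> real" where
  "mirr_theta xB' u = Max {xB' $ i / u $ i |i. i < dim_vec u \<and> u $ i < 0}"

definition mirr_leaving :: "real vec \<Rightarrow> real vec \<Rightarrow> nat" where
  "mirr_leaving xB' u = (LEAST i. i < dim_vec u \<and> u $ i < 0 \<and> xB' $ i / u $ i = mirr_theta xB' u)"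

text \<open>The entering column is appended to a full column rank system.  The row vector
  \<open>a\<^sup>T (I - A\<^sub>B M)\<close> is represented by its transpose \<open>r\<close>.\<close>

definition pinv_append :: "real mat \<Rightarrow> nat list \<Rightarrow> real mat \<Rightarrow> nat \<Rightarrow> real mat" where
  "pinv_append A B M j =
     (let d = dim_row A + 1; k = length B; a = col (tilde_mat A) j;
          r = transpose_mat (1\<^sub>m d - sub_cols (tilde_mat A) B * M) *\<^sub>v a
      in (M @\<^sub>r 0\<^sub>m 1 d)
         - mat_of_cols (k + 1) [(M *\<^sub>v a) @\<^sub>v vec_of_list [-1]] * mat_of_row ((1 / (r \<bullet> a)) \<cdot>\<^sub>v r))"

text \<open>Row \<open>i\<close> of \<open>[M | u']\<close> receives \<open>c i\<close> times row \<open>p\<close>, where \<open>c i\<close> is the multiplier for which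
  the last column becomes the \<open>p\<close>-th unit vector; the last column is then dropped.\<close>

definition pinv_replace :: "real mat \<Rightarrow> real vec \<Rightarrow> nat \<Rightarrow> real mat" where
  "pinv_replace M u' p =
     (let c = (\<lambda>i. (of_bool (i = p) - u' $ i) / u' $ p)
      in mat (dim_row M) (dim_col M) (\<lambda>(i, l). M $$ (i, l) + c i * M $$ (p, l)))"

text \<open>Note the sign of the update of \<open>x\<close>.  The entries of \<open>u\<close> that compete in \<^const>\<open>mirr_theta\<close>
  are negative and \<open>x\<close> is nonnegative, so the maximum is nonpositive.  It is
  \<open>x\<^sub>B\<^sub>' - mirr_theta * u\<close> that stays nonnegative and vanishes at the leaving index; adding
  instead would double that entry.\<close>

definition mirr ::
  "real mat \<Rightarrow> nat list \<Rightarrow> real mat \<Rightarrow> nat \<Rightarrow> real vec \<Rightarrow> real vec \<times> nat list \<times> real mat" where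
  "mirr A B M j x =
     (let B' = B @ [j]; u' = mirr_coeffs A B M j; u = u' @\<^sub>v vec_of_list [-1] in
      if mirr_independent A B M j then (x, B', pinv_append A B M j)
      else
        (let xB' = sub_vec x B';
             p = mirr_leaving xB' u;
             xn = scatter (dim_col A) B' (xB' - mirr_theta xB' u \<cdot>\<^sub>v u)
         in if B' ! p = j then (xn, B, M) else (xn, B[p := j], pinv_replace M u' p)))"

record lss_state =
  xvec :: "real vec"
  zvec :: "real vec"
  supp :: "nat list"
  pinv :: "real mat"

definition lss_init :: "real mat \<Rightarrow> lss_state" where
  "lss_init Q =
     (let A = transpose_mat Q; a = col (tilde_mat A) 0 in
      \<lparr> xvec = unit_vec (dim_row Q) 0, zvec = A *\<^sub>v unit_vec (dim_row Q) 0, supp = [0],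
        pinv = mat_of_row ((1 / (a \<bullet> a)) \<cdot>\<^sub>v a) \<rparr>)"

definition lss_stop :: "real mat \<Rightarrow> lss_state \<Rightarrow> bool" where
  "lss_stop Q s \<longleftrightarrow>
     (\<forall>i < dim_row Q. 0 < (proj_mat Q *\<^sub>v xvec s) $ i) \<or>
     euclid_norm (pos_part (proj_mat Q *\<^sub>v xvec s))
       \<le> 1 / (3 * sqrt (real (dim_row Q))) * inf_norm (xvec s)"

definition move_towards :: "real vec \<Rightarrow> nat \<Rightarrow> real \<Rightarrow> real vec" where
  "move_towards x j \<theta> = x + \<theta> \<cdot>\<^sub>v (unit_vec (dim_vec x) j - x)"

datatype lss_variant = LSP | LSVN

fun lss_stepsize :: "lss_variant \<Rightarrow> real mat \<Rightarrow> nat \<Rightarrow> real vec \<Rightarrow> nat \<Rightarrow> real \<Rightarrow> bool" where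
  "lss_stepsize LSP Q t x j \<theta> \<longleftrightarrow> \<theta> = 1 / (real t + 1)"
| "lss_stepsize LSVN Q t x j \<theta> \<longleftrightarrow>
     \<theta> \<in> {0..1} \<and>
     (\<forall>\<eta>\<in>{0..1}. (euclid_norm (proj_mat Q *\<^sub>v move_towards x j \<theta>))\<^sup>2
                   \<le> (euclid_norm (proj_mat Q *\<^sub>v move_towards x j \<eta>))\<^sup>2)"

text \<open>One iteration.  Ties in the choice of \<open>j\<close> may be broken arbitrarily.\<close>

definition lss_step ::
  "lss_variant \<Rightarrow> real mat \<Rightarrow> nat \<Rightarrow> lss_state \<Rightarrow> nat \<Rightarrow> lss_state \<Rightarrow> bool" where
  "lss_step v Q t s j s' \<longleftrightarrow>
     j < dim_row Q \<and> (\<forall>i < dim_row Q. row Q j \<bullet> zvec s \<le> row Q i \<bullet> zvec s) \<and>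
     (\<exists>\<theta>. lss_stepsize v Q t (xvec s) j \<theta> \<and>
       (let x' = move_towards (xvec s) j \<theta>; A = transpose_mat Q in
        zvec s' = A *\<^sub>v x' \<and>
        (xvec s', supp s', pinv s') =
          (if j \<notin> set (supp s) then mirr A (supp s) (pinv s) j x'
           else (x', supp s, pinv s))))"

text \<open>\<open>S t\<close> is the state after \<open>t\<close> iterations and \<open>J t\<close> the index chosen in iteration \<open>t\<close>.
  Values past the first state that satisfies the stopping condition are meaningless.\<close>

definition lss_execution ::
  "lss_variant \<Rightarrow> real mat \<Rightarrow> (nat \<Rightarrow> lss_state) \<Rightarrow> (nat \<Rightarrow> nat) \<Rightarrow> bool" where
  "lss_execution v Q S J \<longleftrightarrow>
     S 0 = lss_init Q \<and>
     (\<forall>t. (\<forall>s\<le>t. \<not> lss_stop Q (S s)) \<longrightarrow> lss_step v Q t (S t) (J t) (S (Suc t)))"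

text \<open>Each of \<open>+\<close>, \<open>-\<close>, \<open>*\<close>, \<open>/\<close> and each comparison of reals has cost 1.\<close>

definition dot_ops :: "nat \<Rightarrow> nat" where
  "dot_ops d = 2 * d"

definition matvec_ops :: "nat \<Rightarrow> nat \<Rightarrow> nat" where
  "matvec_ops r c = r * dot_ops c"

text \<open>The vector \<open>r\<close> of \<^const>\<open>pinv_append\<close> is evaluated as \<open>a - M\<^sup>T (A\<^sub>B\<^sup>T a)\<close>, with two
  matrix-vector products.  Then come the denominator, the scaling of \<open>r\<close>, and the rank-one
  correction.\<close>

definition pinv_append_ops :: "nat \<Rightarrow> nat \<Rightarrow> nat" where
  "pinv_append_ops d k =
     (matvec_ops k d + matvec_ops d k + d) + dot_ops d + d + 2 * ((k + 1) * d)"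

text \<open>A subtraction and a division for each multiplier, then one operation on each row.\<close>

definition pinv_replace_ops :: "nat \<Rightarrow> nat \<Rightarrow> nat" where
  "pinv_replace_ops d k = 2 * k + 2 * (k * d)"

text \<open>The coefficients; the test for independence; and in the dependent case the sign tests,
  quotients and comparisons of the ratio test, the update of the \<open>k + 1\<close> entries of \<open>x\<close>, and
  the update of the pseudoinverse (charged also when the entering index leaves at once).\<close>

definition mirr_ops :: "real mat \<Rightarrow> nat list \<Rightarrow> real mat \<Rightarrow> nat \<Rightarrow> nat" where
  "mirr_ops A B M j =
     (let d = dim_row A + 1; k = length B
      in matvec_ops k d + (matvec_ops d k + d) +
         (if mirr_independent A B M j then pinv_append_ops d k
          else 3 * (k + 1) + 2 * (k + 1) + pinv_replace_ops d k))"

definition init_ops :: "nat \<Rightarrow> nat" where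
  "init_ops m = dot_ops (m + 1) + (m + 1)"

text \<open>With \<open>z = Q\<^sup>T x\<close> and \<open>q\<close> the \<open>j\<close>-th row of \<open>Q\<close>, the line search minimises
  \<open>\<parallel>z + \<theta> (q - z)\<parallel>\<^sup>2\<close>, whose solution is \<open>z \<bullet> (z - q) / \<parallel>z - q\<parallel>\<^sup>2\<close> clipped to the
  unit interval.\<close>

fun stepsize_ops :: "lss_variant \<Rightarrow> nat \<Rightarrow> nat" where
  "stepsize_ops LSP m = 2"
| "stepsize_ops LSVN m = m + 2 * dot_ops m + 1 + 2"

text \<open>Work of one iteration on producing the next state, once \<open>j\<close> is known: the step size; the
  entries of \<open>x'\<close>, which vanishes outside \<open>B\<close> and \<open>j\<close>; the vector \<open>Q\<^sup>T x'\<close>, formed from these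
  entries only; and the representation reduction.\<close>

definition update_ops :: "lss_variant \<Rightarrow> real mat \<Rightarrow> lss_state \<Rightarrow> nat \<Rightarrow> nat" where
  "update_ops v Q s j =
     (let m = dim_col Q; k = length (supp s) in
      stepsize_ops v m + 3 * (k + 1) + matvec_ops m (k + 1) +
      (if j \<notin> set (supp s) then mirr_ops (transpose_mat Q) (supp s) (pinv s) j else 0))"

text \<open>Work on the stopping test and the choice of \<open>j\<close>, which involve all \<open>n\<close> rows of \<open>Q\<close>.  The
  inner products of these rows with \<open>z\<close> serve both purposes, since \<open>P x = Q z\<close>.  They are followed
  by \<open>n\<close> sign tests and at most \<open>n\<close> comparisons for the minimum, \<open>2 n\<close> operations for the squared
  norm of the positive part, \<open>2 k\<close> for the maximum norm, and 4 for the comparison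
  \<open>9 n \<parallel>(P x)\<^sup>+\<parallel>\<^sup>2 \<le> \<parallel>x\<parallel>\<^sub>\<infinity>\<^sup>2\<close>.\<close>

definition search_ops :: "real mat \<Rightarrow> lss_state \<Rightarrow> nat" where
  "search_ops Q s =
     matvec_ops (dim_row Q) (dim_col Q) + 4 * dim_row Q + 2 * length (supp s) + 4"

text \<open>The first \<open>T\<close> iterations, without and with the work counted by \<^const>\<open>search_ops\<close>; the
  stopping test is performed \<open>T + 1\<close> times.\<close>

definition lss_update_ops ::
  "lss_variant \<Rightarrow> real mat \<Rightarrow> (nat \<Rightarrow> lss_state) \<Rightarrow> (nat \<Rightarrow> nat) \<Rightarrow> nat \<Rightarrow> nat" where
  "lss_update_ops v Q S J T = init_ops (dim_col Q) + (\<Sum>t<T. update_ops v Q (S t) (J t))"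

definition lss_total_ops ::
  "lss_variant \<Rightarrow> real mat \<Rightarrow> (nat \<Rightarrow> lss_state) \<Rightarrow> (nat \<Rightarrow> nat) \<Rightarrow> nat \<Rightarrow> nat" where
  "lss_total_ops v Q S J T = lss_update_ops v Q S J T + (\<Sum>t\<le>T. search_ops Q (S t))"

end

theory Submission
  imports Defs
begin

text \<open>The perceptron estimate: while the method runs, \<open>P x\<^sub>t\<close> has a nonpositive entry, so the
  chosen row satisfies \<open>q\<^sub>j \<bullet> z\<^sub>t \<le> 0\<close>, and together with \<open>\<parallel>q\<^sub>j\<parallel> \<le> 1\<close> a step of size \<open>1 / (t + 1)\<close> preserves
  \<open>t \<parallel>z\<^sub>t\<parallel>\<^sup>2 \<le> 1\<close>.  The representation reduction changes neither \<open>z\<^sub>t\<close> nor the sum of the entries of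
  \<open>x\<^sub>t\<close>, and it keeps the columns \<open>(1, q\<^sub>i)\<close> of the support linearly independent in dimension
  \<open>m + 1\<close>.  Hence the support has at most \<open>m + 1\<close> elements and \<open>\<parallel>x\<^sub>t\<parallel>\<^sub>\<infinity> \<ge> 1 / (m + 1)\<close>, whereas
  \<open>\<parallel>(P x\<^sub>t)\<^sup>+\<parallel> \<le> \<parallel>z\<^sub>t\<parallel> \<le> 1 / \<surd>t\<close>; the two bounds force the stopping condition once
  \<open>t \<ge> 9 (m + 1)\<^sup>2 n\<close>.\<close>

subsection \<open>Pseudoinverses of matrices with independent columns\<close>

text \<open>The other two Penrose conditions follow from \<open>M * N = 1\<close>.\<close>

definition pinv_of :: "real mat \<Rightarrow> real mat \<Rightarrow> bool" where
  "pinv_of N M \<longleftrightarrow>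
     M \<in> carrier_mat (dim_col N) (dim_row N) \<and> M * N = 1\<^sub>m (dim_col N) \<and>
     transpose_mat (N * M) = N * M"

text \<open>The library rules present entries of products as scalar products of rows and columns.
  Sums over \<open>{..<k}\<close> suit the exchanges and splittings below better, so those rules
  leave the simpset and products stay folded until expanded on purpose.\<close>

lemma mult_mat_index:
  "A \<in> carrier_mat r k \<Longrightarrow> B \<in> carrier_mat k c \<Longrightarrow> i < r \<Longrightarrow> j < c \<Longrightarrow>
    (A * B) $$ (i, j) = (\<Sum>l<k. A $$ (i, l) * B $$ (l, j))"
  by (auto simp: scalar_prod_def lessThan_atLeast0)

lemma mult_mat_vec_index:
  "A \<in> carrier_mat r k \<Longrightarrow> v \<in> carrier_vec k \<Longrightarrow> i < r \<Longrightarrow>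
    (A *\<^sub>v v) $ i = (\<Sum>l<k. A $$ (i, l) * v $ l)"
  by (auto simp: scalar_prod_def lessThan_atLeast0)

declare index_mult_mat(1) [simp del] index_mult_mat_vec [simp del]

lemma pinv_of_carrier:
  assumes "pinv_of N M"
  shows "N \<in> carrier_mat (dim_row N) (dim_col N)" "M \<in> carrier_mat (dim_col N) (dim_row N)"
    "N * M \<in> carrier_mat (dim_row N) (dim_row N)"
  using assms by (auto simp: pinv_of_def)

lemma pinv_of_symmetric:
  assumes "pinv_of N M" "i < dim_row N" "j < dim_row N"
  shows "(N * M) $$ (i, j) = (N * M) $$ (j, i)"
proof -
  have "(N * M) $$ (i, j) = transpose_mat (N * M) $$ (j, i)"
    using assms pinv_of_carrier(3)[OF assms(1)] by (intro index_transpose_mat(1)[symmetric]) auto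
  also have "\<dots> = (N * M) $$ (j, i)"
    using assms(1) by (simp only: pinv_of_def)
  finally show ?thesis .
qed

lemma pinv_of_idempotent:
  assumes "pinv_of N M"
  shows "(N * M) * (N * M) = N * M"
proof -
  note N = pinv_of_carrier(1)[OF assms] and M = pinv_of_carrier(2)[OF assms]
  have "(N * M) * (N * M) = N * (M * (N * M))"
    by (rule assoc_mult_mat[OF N M]) (use N M in auto)
  also have "M * (N * M) = (M * N) * M"
    by (rule assoc_mult_mat[symmetric, OF M N M])
  also have "\<dots> = M"
    using assms left_mult_one_mat[OF M] by (simp add: pinv_of_def)
  finally show ?thesis .
qed

text \<open>By symmetry and idempotence the diagonal entry is the sum of the squares of row
  \<open>l\<close>, hence at least its own square. Applied to \<open>Q\<close>, this later bounds
  the norms of its rows.\<close>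

lemma pinv_of_diag_le_1:
  assumes "pinv_of N M" "l < dim_row N"
  shows "(N * M) $$ (l, l) \<le> 1"
proof -
  let ?d = "dim_row N" and ?p = "\<lambda>i. (N * M) $$ (l, i)"
  have NM: "N * M \<in> carrier_mat ?d ?d"
    using assms by (auto simp: pinv_of_def)
  have "?p l = (\<Sum>i<?d. ?p i * (N * M) $$ (i, l))"
    using mult_mat_index[OF NM NM assms(2,2)] pinv_of_idempotent[OF assms(1)] by simp
  also have "\<dots> = (\<Sum>i<?d. (?p i)\<^sup>2)"
    using pinv_of_symmetric[OF assms(1) _ assms(2)]
    by (intro sum.cong refl) (simp add: power2_eq_square)
  finally have "(?p l)\<^sup>2 \<le> ?p l"
    using member_le_sum[of l "{..<?d}" "\<lambda>i. (?p i)\<^sup>2"] assms by simp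
  then have "?p l * (?p l - 1) \<le> 0"
    by (simp add: power2_eq_square algebra_simps)
  then show ?thesis
    by (auto simp: mult_le_0_iff)
qed

text \<open>The trace of the projection \<open>N * M\<close> equals that of \<open>M * N\<close>.\<close>

lemma pinv_of_dim_le:
  assumes "pinv_of N M"
  shows "dim_col N \<le> dim_row N"
proof -
  let ?d = "dim_row N" and ?k = "dim_col N"
  have N: "N \<in> carrier_mat ?d ?k" and M: "M \<in> carrier_mat ?k ?d"
    using assms by (auto simp: pinv_of_def)
  have "real ?k = (\<Sum>i<?k. (M * N) $$ (i, i))"
    using assms by (simp add: pinv_of_def)
  also have "\<dots> = (\<Sum>i<?k. \<Sum>l<?d. M $$ (i, l) * N $$ (l, i))"
    by (intro sum.cong refl) (simp add: mult_mat_index[OF M N])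
  also have "\<dots> = (\<Sum>l<?d. \<Sum>i<?k. N $$ (l, i) * M $$ (i, l))"
    by (subst sum.swap) (simp add: mult.commute)
  also have "\<dots> = (\<Sum>l<?d. (N * M) $$ (l, l))"
    by (intro sum.cong refl) (simp add: mult_mat_index[OF N M])
  also have "\<dots> \<le> (\<Sum>l<?d. 1)"
    by (intro sum_mono pinv_of_diag_le_1[OF assms]) simp
  finally show ?thesis by simp
qed

text \<open>With \<open>P = N * M\<close> the orthogonal projection onto the column space,
  \<open>r = a - P a\<close> is orthogonal to every column of \<open>N\<close>, and
  \<open>r \<bullet> a = r \<bullet> r > 0\<close>. So the last row of the new matrix, a multiple of
  \<open>r\<close>, sends \<open>a\<close> to 1 and the old columns to 0; subtracting
  \<open>u $ i\<close> times it from row \<open>i\<close> of \<open>M\<close> cancels the value at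
  \<open>a\<close>. The new projection is \<open>P\<close> plus the projection onto the line of
  \<open>r\<close>.\<close>

lemma pinv_of_append:
  assumes N: "N \<in> carrier_mat d k" and pinv: "pinv_of N M" and a: "a \<in> carrier_vec d"
    and indep: "N *\<^sub>v (M *\<^sub>v a) \<noteq> a"
    and r: "r = transpose_mat (1\<^sub>m d - N * M) *\<^sub>v a"
    and N': "N' \<in> carrier_mat d (k + 1)" "\<And>i. i < k \<Longrightarrow> col N' i = col N i" "col N' k = a"
  shows "pinv_of N' ((M @\<^sub>r 0\<^sub>m 1 d)
    - mat_of_cols (k + 1) [(M *\<^sub>v a) @\<^sub>v vec_of_list [-1]] * mat_of_row ((1 / (r \<bullet> a)) \<cdot>\<^sub>v r))"
    (is "pinv_of N' ?M'")
proof -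
  define P u s where "P = N * M" and "u = M *\<^sub>v a" and "s = 1 / (r \<bullet> a)"
  have M: "M \<in> carrier_mat k d" using pinv N by (simp add: pinv_of_def)
  have MN: "M * N = 1\<^sub>m k" using pinv N by (simp add: pinv_of_def)
  have P: "P \<in> carrier_mat d d" using N M by (simp add: P_def)
  have sym: "P $$ (i, l) = P $$ (l, i)" if "i < d" "l < d" for i l
    using pinv_of_symmetric[OF pinv] N that by (simp add: P_def)
  have uc: "u \<in> carrier_vec k" using M a by (simp add: u_def)
  have Pa: "P *\<^sub>v a = N *\<^sub>v u" using N M a by (simp add: P_def u_def)
  \<comment> \<open>Symmetry of \<open>P\<close> removes the transpose from the definition of
    \<open>r\<close>.\<close>
  have "transpose_mat (1\<^sub>m d - P) = 1\<^sub>m d - P"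
    using P sym by (intro eq_matI) auto
  then have "r = (1\<^sub>m d - P) *\<^sub>v a" by (simp add: r P_def)
  also have "\<dots> = 1\<^sub>m d *\<^sub>v a - P *\<^sub>v a"
    using P a by (intro minus_mult_distrib_mat_vec) auto
  finally have r': "r = a - N *\<^sub>v u" using a Pa by simp
  have Nu: "N *\<^sub>v u \<in> carrier_vec d" using N uc by simp
  have rc: "r \<in> carrier_vec d" using r' a Nu by simp
  have ri: "r $ i = a $ i - (\<Sum>l<d. P $$ (i, l) * a $ l)" if "i < d" for i
    using mult_mat_vec_index[OF P a that] that a Nu Pa N by (simp add: r')
  have PN: "P * N = N"
  proof -
    have "P * N = N * (M * N)" unfolding P_def by (rule assoc_mult_mat[OF N M N])
    then show ?thesis using MN N by simp
  qed
  \<comment> \<open>By symmetry \<open>P\<close> can be moved over to the column of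
    \<open>N\<close>, which it fixes.\<close>
  have col0: "r \<bullet> col N i = 0" if i: "i < k" for i
  proof -
    have "r \<bullet> col N i = (\<Sum>l<d. a $ l * N $$ (l, i)) - (\<Sum>l<d. (\<Sum>l'<d. P $$ (l, l') * a $ l') * N $$ (l, i))"
      using rc N i by (simp add: scalar_prod_def lessThan_atLeast0[symmetric] ri left_diff_distrib sum_subtractf)
    also have "(\<Sum>l<d. (\<Sum>l'<d. P $$ (l, l') * a $ l') * N $$ (l, i))
        = (\<Sum>l'<d. a $ l' * (\<Sum>l<d. P $$ (l', l) * N $$ (l, i)))"
      unfolding sum_distrib_left sum_distrib_right
      by (subst sum.swap, intro sum.cong refl) (simp add: sym mult_ac)
    also have "\<dots> = (\<Sum>l'<d. a $ l' * N $$ (l', i))"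
      by (intro sum.cong refl) (simp add: i PN flip: mult_mat_index[OF P N])
    finally show ?thesis by simp
  qed
  \<comment> \<open>\<open>a\<close> and \<open>r\<close> differ by \<open>N u\<close>, a
    combination of columns to which \<open>r\<close> is orthogonal.\<close>
  have ra: "r \<bullet> a = r \<bullet> r"
  proof -
    have "r \<bullet> (N *\<^sub>v u) = (\<Sum>l<d. \<Sum>i<k. r $ l * N $$ (l, i) * u $ i)"
      using rc Nu N by (simp add: scalar_prod_def[of r] lessThan_atLeast0[symmetric]
          mult_mat_vec_index[OF N uc] sum_distrib_left mult_ac)
    also have "\<dots> = (\<Sum>i<k. (r \<bullet> col N i) * u $ i)"
      using N by (subst sum.swap) (simp add: scalar_prod_def lessThan_atLeast0[symmetric] sum_distrib_right)
    finally have "r \<bullet> (N *\<^sub>v u) = 0" using col0 by simp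
    then have "r \<bullet> (a - N *\<^sub>v u) = r \<bullet> a"
      using Nu a rc by (simp add: scalar_prod_minus_distrib[of _ d])
    then show ?thesis using r' by simp
  qed
  \<comment> \<open>A zero residual would mean \<open>N u = a\<close>, against \<open>indep\<close>;
    hence the denominator \<open>r \<bullet> a\<close> is positive.\<close>
  have "r \<noteq> 0\<^sub>v d"
  proof
    assume r0: "r = 0\<^sub>v d"
    have "N *\<^sub>v u = a"
    proof (rule eq_vecI)
      fix i assume "i < dim_vec a"
      then have "i < d" using a by simp
      moreover have "r $ i = a $ i - (N *\<^sub>v u) $ i"
        using N \<open>i < d\<close> by (subst r') simp
      ultimately show "(N *\<^sub>v u) $ i = a $ i" using r0 by simp
    qed (use a N in simp)
    then show False using indep by (simp add: u_def)
  qed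
  then obtain l where "l < d" "r $ l \<noteq> 0" using rc by (metis carrier_vecD eq_vecI index_zero_vec)
  then have "r \<bullet> r > 0"
    using rc by (auto simp: scalar_prod_def intro!: sum_pos2[of _ l] simp flip: power2_eq_square)
  then have s: "s * (r \<bullet> a) = 1" by (simp add: s_def ra)
  define M' where "M' = ?M'"
  have M': "M' \<in> carrier_mat (k + 1) d"
    unfolding M'_def using M rc by (intro minus_carrier_mat mult_carrier_mat[of _ _ 1]) auto
  have M'i: "M' $$ (i, l) = (if i < k then M $$ (i, l) - u $ i * (s * r $ l) else s * r $ l)"
    if "i < k + 1" "l < d" for i l
  proof -
    have "(M @\<^sub>r 0\<^sub>m 1 d) $$ (i, l) = (if i < k then M $$ (i, l) else 0)"
      using M that by (auto simp: append_rows_def)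
    moreover have "(mat_of_cols (k + 1) [u @\<^sub>v vec_of_list [-1]] * mat_of_row (s \<cdot>\<^sub>v r)) $$ (i, l)
       = (if i < k then u $ i else - 1) * (s * r $ l)"
      using uc rc that by (auto simp: scalar_prod_def mat_of_cols_def index_mult_mat(1))
    ultimately show ?thesis
      using M uc rc that by (auto simp: M'_def simp flip: u_def s_def)
  qed
  have N'i: "N' $$ (l, i) = (if i < k then N $$ (l, i) else a $ l)" if "i < k + 1" "l < d" for i l
  proof (cases "i < k")
    case True
    then have "col N' i $ l = col N i $ l" using N'(2) by simp
    then show ?thesis using N N'(1) that True by simp
  next
    case False
    then have "col N' i $ l = a $ l" using N'(3) that by (simp add: less_Suc_eq)
    then show ?thesis using N'(1) that False by (simp add: less_Suc_eq)
  qed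
  have inv: "(M' * N') $$ (i, j) = 1\<^sub>m (k + 1) $$ (i, j)" if i: "i < k + 1" and j: "j < k + 1" for i j
  proof -
    \<comment> \<open>\<open>c\<close> is column \<open>j\<close> of \<open>N'\<close>, so old and
      new columns share one computation.\<close>
    define c where "c = (\<lambda>l. if j < k then N $$ (l, j) else a $ l)"
    have rcj: "(\<Sum>l<d. r $ l * c l) = (if j < k then 0 else r \<bullet> a)"
      using col0[of j] N a by (auto simp: c_def scalar_prod_def lessThan_atLeast0)
    have Mc: "(\<Sum>l<d. M $$ (i, l) * c l) = (if j < k then of_bool (i = j) else u $ i)" if "i < k"
      using mult_mat_index[OF M N that, of j] MN that mult_mat_vec_index[OF M a that]
      by (auto simp: c_def u_def)
    have "(M' * N') $$ (i, j) = (\<Sum>l<d. M' $$ (i, l) * N' $$ (l, j))"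
      by (rule mult_mat_index[OF M' N'(1) i j])
    also have "\<dots> = (\<Sum>l<d. (if i < k then M $$ (i, l) - u $ i * (s * r $ l) else s * r $ l) * c l)"
      using i j by (intro sum.cong refl) (simp add: M'i N'i c_def)
    also have "\<dots> = (if i < k then (\<Sum>l<d. M $$ (i, l) * c l) - u $ i * s * (\<Sum>l<d. r $ l * c l)
        else s * (\<Sum>l<d. r $ l * c l))"
      by (simp add: sum_subtractf left_diff_distrib right_diff_distrib sum_distrib_left mult_ac)
    also have "\<dots> = 1\<^sub>m (k + 1) $$ (i, j)"
      using i j s Mc rcj by (auto simp: mult.assoc)
    finally show ?thesis .
  qed
  \<comment> \<open>The terms with \<open>a\<close> cancel since \<open>N u = a - r\<close>, which
    leaves a visibly symmetric matrix.\<close>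
  have NM: "(N' * M') $$ (l, l') = P $$ (l, l') + s * r $ l * r $ l'" if l: "l < d" and l': "l' < d" for l l'
  proof -
    have "(N' * M') $$ (l, l') = (\<Sum>i<k + 1. N' $$ (l, i) * M' $$ (i, l'))"
      by (rule mult_mat_index[OF N'(1) M' l l'])
    also have "\<dots> = (\<Sum>i<k. N $$ (l, i) * (M $$ (i, l') - u $ i * (s * r $ l'))) + a $ l * (s * r $ l')"
      using l l' by (simp add: M'i N'i)
    also have "(\<Sum>i<k. N $$ (l, i) * (M $$ (i, l') - u $ i * (s * r $ l')))
       = P $$ (l, l') - (N *\<^sub>v u) $ l * (s * r $ l')"
      unfolding P_def mult_mat_index[OF N M l l'] mult_mat_vec_index[OF N uc l] sum_distrib_right
      by (simp add: right_diff_distrib sum_subtractf mult_ac)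
    also have "(N *\<^sub>v u) $ l = a $ l - r $ l"
      unfolding r' using a N l by simp
    finally show ?thesis by (simp add: algebra_simps)
  qed
  have "M' * N' = 1\<^sub>m (k + 1)"
    using M' N' by (intro eq_matI inv) auto
  moreover have "transpose_mat (N' * M') = N' * M'"
  proof (rule eq_matI)
    fix i j assume "i < dim_row (N' * M')" "j < dim_col (N' * M')"
    then have "i < d" "j < d" using M' N' by auto
    then show "transpose_mat (N' * M') $$ (i, j) = (N' * M') $$ (i, j)"
      using index_transpose_mat(1)[of i "N' * M'" j] M' N'(1) NM sym
      by (simp add: mult_ac)
  qed (use M' N' in auto)
  ultimately show ?thesis
    unfolding M'_def[symmetric] using M' N' by (simp add: pinv_of_def)
qed

text \<open>The row operations send \<open>u = M a\<close> to the unit vector at \<open>p\<close>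
  and fix all other unit vectors, which gives the left inverse. Exchanging column \<open>p\<close>
  for \<open>a\<close> keeps the column space because \<open>u $ p\<close> is nonzero, so the
  projection \<open>N * M\<close> is unchanged and its symmetry is inherited.\<close>

lemma pinv_of_replace:
  assumes N: "N \<in> carrier_mat d k" and pinv: "pinv_of N M" and a: "a \<in> carrier_vec d"
    and u: "u = M *\<^sub>v a" and dep: "N *\<^sub>v u = a" and p: "p < k" "u $ p \<noteq> 0"
    and N': "N' \<in> carrier_mat d k" "\<And>i. i < k \<Longrightarrow> col N' i = (if i = p then a else col N i)"
  shows "pinv_of N' (pinv_replace M u p)"
proof -
  let ?M' = "pinv_replace M u p"
  have M: "M \<in> carrier_mat k d" using pinv N by (simp add: pinv_of_def)
  have MN: "M * N = 1\<^sub>m k" using pinv N by (simp add: pinv_of_def)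
  have uc: "u \<in> carrier_vec k" using M a by (simp add: u)
  have M': "?M' \<in> carrier_mat k d" using M by (simp add: pinv_replace_def Let_def)
  define c where "c = (\<lambda>i. (of_bool (i = p) - u $ i) / u $ p)"
  have M'i: "?M' $$ (i, l) = M $$ (i, l) + c i * M $$ (p, l)" if "i < k" "l < d" for i l
    using M that by (simp add: pinv_replace_def Let_def c_def)
  have N'i: "N' $$ (l, i) = (if i = p then a $ l else N $$ (l, i))" if "i < k" "l < d" for i l
  proof -
    have "col N' i $ l = (if i = p then a else col N i) $ l" using N'(2)[OF that(1)] by simp
    then show ?thesis using N N'(1) that by (simp split: if_splits)
  qed
  have inv: "(?M' * N') $$ (i, j) = 1\<^sub>m k $$ (i, j)" if i: "i < k" and j: "j < k" for i j
  proof -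
    define b where "b = (\<lambda>l. if j = p then a $ l else N $$ (l, j))"
    have Mb: "(\<Sum>l<d. M $$ (i, l) * b l) = (if j = p then u $ i else of_bool (i = j))" if "i < k" for i
      using mult_mat_index[OF M N that j] MN j that mult_mat_vec_index[OF M a that]
      by (auto simp: b_def u)
    have "(?M' * N') $$ (i, j) = (\<Sum>l<d. (M $$ (i, l) + c i * M $$ (p, l)) * b l)"
      unfolding mult_mat_index[OF M' N'(1) i j]
      using i j by (intro sum.cong refl) (simp add: M'i N'i b_def)
    also have "\<dots> = (\<Sum>l<d. M $$ (i, l) * b l) + c i * (\<Sum>l<d. M $$ (p, l) * b l)"
      by (simp add: algebra_simps sum.distrib sum_distrib_left)
    also have "\<dots> = 1\<^sub>m k $$ (i, j)"
      using i j p by (auto simp: Mb c_def)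
    finally show ?thesis .
  qed
  have NM: "N' * ?M' = N * M"
  proof (rule eq_matI)
    fix l l' assume "l < dim_row (N * M)" "l' < dim_col (N * M)"
    then have l: "l < d" "l' < d" using N M by auto
    \<comment> \<open>Term \<open>p\<close> is split off. Row \<open>p\<close> of the new matrix is
      row \<open>p\<close> of \<open>M\<close> divided by \<open>u $ p\<close>; the multiples of it
      subtracted from the other rows cancel against the expansion \<open>al\<close> of
      \<open>a\<close>.\<close>
    have split: "sum f {..<k} = f p + sum f ({..<k} - {p})" for f :: "nat \<Rightarrow> real"
      using p by (simp add: sum.remove)
    have "a $ l = (\<Sum>i<k. N $$ (l, i) * u $ i)"
      using mult_mat_vec_index[OF N uc l(1)] dep by simp
    then have al: "a $ l = N $$ (l, p) * u $ p + (\<Sum>i\<in>{..<k} - {p}. N $$ (l, i) * u $ i)"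
      by (simp only: split)
    have "(N' * ?M') $$ (l, l') = (\<Sum>i<k. (if i = p then a $ l else N $$ (l, i)) * (M $$ (i, l') + c i * M $$ (p, l')))"
      unfolding mult_mat_index[OF N'(1) M' l]
      using l by (intro sum.cong refl) (simp add: M'i N'i)
    also have "\<dots> = a $ l * (M $$ (p, l') + c p * M $$ (p, l'))
        + (\<Sum>i\<in>{..<k} - {p}. N $$ (l, i) * (M $$ (i, l') + c i * M $$ (p, l')))"
      unfolding split by simp
    also have "M $$ (p, l') + c p * M $$ (p, l') = M $$ (p, l') / u $ p"
      using p by (simp add: c_def field_simps)
    also have "(\<Sum>i\<in>{..<k} - {p}. N $$ (l, i) * (M $$ (i, l') + c i * M $$ (p, l')))
        = (\<Sum>i\<in>{..<k} - {p}. N $$ (l, i) * M $$ (i, l'))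
          - (\<Sum>i\<in>{..<k} - {p}. N $$ (l, i) * u $ i) * (M $$ (p, l') / u $ p)"
      unfolding sum_distrib_right sum_subtractf[symmetric]
      by (intro sum.cong refl) (auto simp: c_def field_simps)
    also have "a $ l * (M $$ (p, l') / u $ p) + \<dots>
        = N $$ (l, p) * M $$ (p, l') + (\<Sum>i\<in>{..<k} - {p}. N $$ (l, i) * M $$ (i, l'))"
      using p by (simp add: al algebra_simps)
    also have "\<dots> = (N * M) $$ (l, l')"
      unfolding mult_mat_index[OF N M l] split ..
    finally show "(N' * ?M') $$ (l, l') = (N * M) $$ (l, l')" .
  qed (use N N' M M' in auto)
  have "?M' * N' = 1\<^sub>m k"
    using M' N' by (intro eq_matI inv) auto
  then show ?thesis
    using M' N' NM pinv by (simp add: pinv_of_def)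
qed

subsection \<open>Representation reduction\<close>

lemma sub_cols_carrier [simp]: "sub_cols N B \<in> carrier_mat (dim_row N) (length B)"
  unfolding sub_cols_def by (rule carrier_matI) simp_all

lemma col_sub_cols [simp]: "i < length B \<Longrightarrow> col (sub_cols N B) i = col N (B ! i)"
  by (simp add: sub_cols_def col_mat_of_cols)

lemma sub_cols_dim [simp]: "dim_row (sub_cols N B) = dim_row N" "dim_col (sub_cols N B) = length B"
  by (simp_all add: sub_cols_def)

lemma sub_cols_index:
  "l < dim_row N \<Longrightarrow> i < length B \<Longrightarrow> B ! i < dim_col N \<Longrightarrow> sub_cols N B $$ (l, i) = N $$ (l, B ! i)"
  by (simp add: sub_cols_def mat_of_cols_index)

lemma tilde_mat_carrier [simp]: "A \<in> carrier_mat m n \<Longrightarrow> tilde_mat A \<in> carrier_mat (m + 1) n"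
  by (auto simp: tilde_mat_def)

lemma tilde_mat_dim [simp]: "dim_row (tilde_mat A) = dim_row A + 1" "dim_col (tilde_mat A) = dim_col A"
  by (simp_all add: tilde_mat_def)

lemma tilde_mat_mult_vec:
  assumes A: "A \<in> carrier_mat m n" and x: "x \<in> carrier_vec n"
  shows "(tilde_mat A *\<^sub>v x) $ 0 = (\<Sum>i<n. x $ i)"
    and "l < m \<Longrightarrow> (tilde_mat A *\<^sub>v x) $ Suc l = (A *\<^sub>v x) $ l"
proof -
  note * = mult_mat_vec_index[OF tilde_mat_carrier[OF A] x]
  show "(tilde_mat A *\<^sub>v x) $ 0 = (\<Sum>i<n. x $ i)"
    using A by (subst *) (auto simp: tilde_mat_def intro!: sum.cong)
  assume l: "l < m"
  show "(tilde_mat A *\<^sub>v x) $ Suc l = (A *\<^sub>v x) $ l"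
    unfolding mult_mat_vec_index[OF A x l]
    using A l by (subst *) (auto simp: tilde_mat_def intro!: sum.cong)
qed

text \<open>The row of ones makes the total mass part of the image: a change within the kernel of
  the lifted matrix preserves both \<open>A x\<close> and the sum of the entries.\<close>

lemma tilde_mat_mult_vec_eqD:
  assumes A: "A \<in> carrier_mat m n" and x: "x \<in> carrier_vec n" and y: "y \<in> carrier_vec n"
    and eq: "tilde_mat A *\<^sub>v x = tilde_mat A *\<^sub>v y"
  shows "A *\<^sub>v x = A *\<^sub>v y" "(\<Sum>i<n. x $ i) = (\<Sum>i<n. y $ i)"
proof -
  show "A *\<^sub>v x = A *\<^sub>v y"
  proof (rule eq_vecI)
    fix l assume "l < dim_vec (A *\<^sub>v y)"
    then have "l < m" using A by simp
    then show "(A *\<^sub>v x) $ l = (A *\<^sub>v y) $ l"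
      using tilde_mat_mult_vec(2)[OF A x, of l] tilde_mat_mult_vec(2)[OF A y, of l] eq by simp
  qed simp
  show "(\<Sum>i<n. x $ i) = (\<Sum>i<n. y $ i)"
    using tilde_mat_mult_vec(1)[OF A x] tilde_mat_mult_vec(1)[OF A y] eq by simp
qed

lemma scatter_carrier [simp]: "scatter n B w \<in> carrier_vec n"
  and scatter_dim [simp]: "dim_vec (scatter n B w) = n"
  by (simp_all add: scatter_def)

lemma scatter_nth:
  assumes "distinct B" "i < length B" "B ! i < n"
  shows "scatter n B w $ (B ! i) = w $ i"
proof -
  have "{i'. i' < length B \<and> B ! i' = B ! i} = {i}"
    using assms nth_eq_iff_index_eq by auto
  then show ?thesis using assms by (simp add: scatter_def)
qed

lemma scatter_notin: "l < n \<Longrightarrow> l \<notin> set B \<Longrightarrow> scatter n B w $ l = 0"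
  by (auto simp: scatter_def intro!: sum.neutral)

lemma mult_scatter:
  assumes N: "N \<in> carrier_mat d n" and B: "set B \<subseteq> {..<n}" and w: "w \<in> carrier_vec (length B)"
  shows "N *\<^sub>v scatter n B w = sub_cols N B *\<^sub>v w"
proof (rule eq_vecI)
  fix l assume "l < dim_vec (sub_cols N B *\<^sub>v w)"
  then have l: "l < d" using N by simp
  have S: "sub_cols N B \<in> carrier_mat d (length B)" using N sub_cols_carrier[of N B] by simp
  have "(N *\<^sub>v scatter n B w) $ l = (\<Sum>j<n. N $$ (l, j) * (\<Sum>i | i < length B \<and> B ! i = j. w $ i))"
    unfolding mult_mat_vec_index[OF N scatter_carrier l]
    by (intro sum.cong refl) (simp add: scatter_def)
  \<comment> \<open>On the fibre over \<open>j\<close> the column index may be written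
    \<open>B ! i\<close>; then \<open>sum.group\<close> merges the fibres.\<close>
  also have "\<dots> = (\<Sum>j<n. \<Sum>i | i \<in> {..<length B} \<and> B ! i = j. N $$ (l, B ! i) * w $ i)"
    by (intro sum.cong refl) (auto simp: sum_distrib_left intro!: sum.cong)
  also have "\<dots> = (\<Sum>i<length B. N $$ (l, B ! i) * w $ i)"
    using B by (intro sum.group) (auto simp: subset_iff)
  also have "\<dots> = (sub_cols N B *\<^sub>v w) $ l"
    unfolding mult_mat_vec_index[OF S w l]
    using B N l by (intro sum.cong refl) (auto simp: sub_cols_index subset_iff)
  finally show "(N *\<^sub>v scatter n B w) $ l = (sub_cols N B *\<^sub>v w) $ l" .
qed (use N in simp)

lemma sub_vec_carrier [simp]: "sub_vec x B \<in> carrier_vec (length B)"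
  unfolding sub_vec_def by (rule carrier_vecI) simp

lemma sub_vec_nth [simp]: "i < length B \<Longrightarrow> sub_vec x B $ i = x $ (B ! i)"
  by (simp add: sub_vec_def vec_of_list_index)

lemma scatter_sub_vec:
  assumes "x \<in> carrier_vec n" "distinct B" "set B \<subseteq> {..<n}" "\<And>i. i < n \<Longrightarrow> i \<notin> set B \<Longrightarrow> x $ i = 0"
  shows "scatter n B (sub_vec x B) = x"
proof (rule eq_vecI)
  fix l assume "l < dim_vec x"
  then have l: "l < n" using assms by simp
  show "scatter n B (sub_vec x B) $ l = x $ l"
  proof (cases "l \<in> set B")
    case True
    then obtain i where "i < length B" "B ! i = l" by (auto simp: in_set_conv_nth)
    then show ?thesis using scatter_nth[OF assms(2), of i n] l by auto
  qed (use l scatter_notin assms in auto)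
qed (use assms(1) in simp)

text \<open>The face of the standard simplex spanned by the unit vectors with index in
  \<open>I\<close>.\<close>

definition face :: "nat \<Rightarrow> nat set \<Rightarrow> real vec set" where
  "face n I = {x \<in> carrier_vec n. (\<forall>i<n. 0 \<le> x $ i) \<and> (\<Sum>i<n. x $ i) = 1 \<and>
     (\<forall>i<n. i \<notin> I \<longrightarrow> x $ i = 0)}"

section \<open>The ratio test and correctness of the reduction\<close>

lemma mirr_theta_ratio:
  assumes "i < dim_vec u" "u $ i < 0"
  shows "x $ i / u $ i \<le> mirr_theta x u"
proof -
  have "{x $ i / u $ i |i. i < dim_vec u \<and> u $ i < 0} = (\<lambda>i. x $ i / u $ i) ` {i. i < dim_vec u \<and> u $ i < 0}"
    by auto
  then show ?thesis
    unfolding mirr_theta_def using assms by (auto intro!: Max_ge)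
qed

text \<open>The set of ratios is finite and, by the given negative entry, nonempty; so its maximum
  is attained and \<open>LEAST\<close> selects a genuine index.\<close>

lemma mirr_leaving:
  assumes "i < dim_vec u" "u $ i < 0"
  shows "mirr_leaving x u < dim_vec u \<and> u $ mirr_leaving x u < 0 \<and>
    x $ mirr_leaving x u / u $ mirr_leaving x u = mirr_theta x u"
proof -
  let ?I = "{i. i < dim_vec u \<and> u $ i < 0}"
  have "{x $ i / u $ i |i. i < dim_vec u \<and> u $ i < 0} = (\<lambda>i. x $ i / u $ i) ` ?I"
    by auto
  then have "mirr_theta x u \<in> (\<lambda>i. x $ i / u $ i) ` ?I"
    unfolding mirr_theta_def using assms by (simp only:) (rule Max_in; auto)
  then obtain i where "i < dim_vec u \<and> u $ i < 0 \<and> x $ i / u $ i = mirr_theta x u" by auto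
  then show ?thesis
    unfolding mirr_leaving_def by (rule LeastI)
qed

lemma mirr_correct:
  assumes A: "A \<in> carrier_mat m n" and B: "distinct B" "set B \<subseteq> {..<n}" and j: "j < n" "j \<notin> set B"
    and pinv: "pinv_of (sub_cols (tilde_mat A) B) M" and x: "x \<in> face n (insert j (set B))"
    and out: "mirr A B M j x = (x', B', M')"
  shows "distinct B' \<and> set B' \<subseteq> {..<n} \<and> x' \<in> face n (set B') \<and> A *\<^sub>v x' = A *\<^sub>v x \<and>
    pinv_of (sub_cols (tilde_mat A) B') M'"
proof -
  let ?N = "sub_cols (tilde_mat A)" and ?k = "length B" and ?Bj = "B @ [j]" and ?a = "col (tilde_mat A) j"
  define u' where "u' = mirr_coeffs A B M j"
  define u where "u = u' @\<^sub>v vec_of_list [-1]"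
  have N: "?N C \<in> carrier_mat (m + 1) (length C)" for C
    using A sub_cols_carrier[of "tilde_mat A" C] by simp
  have a: "?a \<in> carrier_vec (m + 1)" using A by (intro carrier_vecI) auto
  have M: "M \<in> carrier_mat ?k (m + 1)" using pinv_of_carrier(2)[OF pinv] A by simp
  have u'c: "u' \<in> carrier_vec ?k" using M a by (simp add: u'_def mirr_coeffs_def)
  have Bj: "distinct ?Bj" "set ?Bj \<subseteq> {..<n}" using B j by auto
  show ?thesis
  proof (cases "mirr_independent A B M j")
    case True
    have "pinv_of (?N ?Bj) (pinv_append A B M j)"
      unfolding pinv_append_def Let_def carrier_matD(1)[OF A]
      using True N[of ?Bj]
      by (intro pinv_of_append[OF N pinv a _ refl])
        (auto simp: mirr_independent_def mirr_coeffs_def nth_append)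
    then show ?thesis
      using True out x Bj by (auto simp: mirr_def Let_def)
  next
    case False
    then have dep: "?N B *\<^sub>v u' = ?a" by (simp add: mirr_independent_def u'_def)
    define xB where "xB = sub_vec x ?Bj"
    define \<theta> where "\<theta> = mirr_theta xB u"
    define p where "p = mirr_leaving xB u"
    define w where "w = xB - \<theta> \<cdot>\<^sub>v u"
    define xn where "xn = scatter n ?Bj w"
    have out': "(x', B', M') = (if ?Bj ! p = j then (xn, B, M) else (xn, B[p := j], pinv_replace M u' p))"
      using out unfolding mirr_def Let_def xn_def w_def \<theta>_def p_def xB_def u_def u'_def
      by (simp only: False if_False carrier_matD(2)[OF A])
    have uc: "u \<in> carrier_vec (?k + 1)" unfolding u_def using u'c by (intro carrier_vecI) simp
    have ui: "u $ i = (if i < ?k then u' $ i else -1)" if "i < ?k + 1" for i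
      using u'c that by (auto simp: u_def)
    have xBc: "xB \<in> carrier_vec (?k + 1)" using sub_vec_carrier[of x ?Bj] by (simp add: xB_def)
    have wc: "w \<in> carrier_vec (?k + 1)" using uc xBc by (simp add: w_def)
    have xBi: "xB $ i = x $ (?Bj ! i)" if "i < ?k + 1" for i using that by (simp add: xB_def)
    have xB0: "xB $ i \<ge> 0" if "i < ?k + 1" for i
      using x xBi[OF that] nth_mem[of i ?Bj] Bj(2) that by (auto simp: face_def)
    \<comment> \<open>The entry -1 at position \<open>?k\<close> guarantees a candidate for the
      ratio test.\<close>
    have p: "p < ?k + 1" "u $ p < 0" "xB $ p / u $ p = \<theta>"
      using mirr_leaving[of ?k u xB] uc ui[of ?k] by (auto simp: p_def \<theta>_def)
    have \<theta>0: "\<theta> \<le> 0"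
      using p xB0[of p] by (auto simp: divide_nonneg_neg)
    have wi: "w $ i = xB $ i - \<theta> * u $ i" if "i < ?k + 1" for i
      using that uc xBc by (simp add: w_def)
    \<comment> \<open>Where \<open>u\<close> is negative, maximality of \<open>\<theta>\<close>
      decides the sign; elsewhere \<open>\<theta> \<le> 0\<close> does.\<close>
    have w0: "w $ i \<ge> 0" if i: "i < ?k + 1" for i
    proof (cases "u $ i < 0")
      case True
      then have "xB $ i / u $ i \<le> \<theta>"
        using mirr_theta_ratio[of i u xB] uc i by (simp add: \<theta>_def)
      then show ?thesis using True wi[OF i] by (simp add: field_simps)
    next
      case False
      then show ?thesis using \<theta>0 wi[OF i] xB0[OF i] by (simp add: mult_nonpos_nonneg order_trans[of _ 0])
    qed
    have wp: "w $ p = 0" using wi[OF p(1)] p(2,3) by (simp add: field_simps)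
    have xnc: "xn \<in> carrier_vec n" by (simp add: xn_def)
    have xn_nth: "xn $ (?Bj ! i) = w $ i" if "i < ?k + 1" for i
      using scatter_nth[OF Bj(1), of i n w] that Bj(2) nth_mem[of i ?Bj] by (auto simp: xn_def)
    have xn_out: "xn $ l = 0" if "l < n" "l \<notin> set ?Bj" for l
      using scatter_notin[OF that] by (simp add: xn_def)
    have xn0: "xn $ l \<ge> 0" if "l < n" for l
    proof (cases "l \<in> set ?Bj")
      case True
      then obtain i where "i < ?k + 1" "?Bj ! i = l" by (metis in_set_conv_nth length_append_singleton Suc_eq_plus1)
      then show ?thesis using xn_nth w0 by metis
    qed (use that xn_out in simp)
    \<comment> \<open>\<open>u'\<close> reproduces column \<open>j\<close> from the columns in
      \<open>B\<close>, and the final -1 cancels it.\<close>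
    have Nu: "?N ?Bj *\<^sub>v u = 0\<^sub>v (m + 1)"
    proof (rule eq_vecI)
      fix l assume "l < dim_vec (0\<^sub>v (m + 1) :: real vec)"
      then have l: "l < m + 1" by simp
      have "(?N ?Bj *\<^sub>v u) $ l = (\<Sum>i<?k + 1. ?N ?Bj $$ (l, i) * u $ i)"
        using N[of ?Bj] uc l by (intro mult_mat_vec_index[of _ "m + 1"]) auto
      also have "\<dots> = (\<Sum>i<?k. ?N B $$ (l, i) * u' $ i) - ?a $ l"
        using l A B j ui by (auto simp: sub_cols_index nth_append subset_iff)
      also have "\<dots> = (?N B *\<^sub>v u') $ l - ?a $ l"
        using mult_mat_vec_index[OF N u'c l] by simp
      finally show "(?N ?Bj *\<^sub>v u) $ l = 0\<^sub>v (m + 1) $ l" using dep l by simp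
    qed (use A in simp)
    have "tilde_mat A *\<^sub>v xn = ?N ?Bj *\<^sub>v w"
      unfolding xn_def using mult_scatter[OF tilde_mat_carrier[OF A] Bj(2)] wc by simp
    also have "\<dots> = ?N ?Bj *\<^sub>v xB - \<theta> \<cdot>\<^sub>v (?N ?Bj *\<^sub>v u)"
      unfolding w_def using N[of ?Bj] xBc uc
      by (simp add: mult_minus_distrib_mat_vec[of _ "m + 1" "?k + 1"] mult_mat_vec[of _ "m + 1" "?k + 1"])
    also have "\<dots> = ?N ?Bj *\<^sub>v xB"
      unfolding Nu using N[of ?Bj] by (auto simp: vec_eq_iff)
    also have "\<dots> = tilde_mat A *\<^sub>v x"
    proof -
      have "scatter n ?Bj xB = x"
        unfolding xB_def using x Bj by (intro scatter_sub_vec) (auto simp: face_def)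
      then show ?thesis
        using mult_scatter[OF tilde_mat_carrier[OF A] Bj(2), of xB] xBc by simp
    qed
    finally have eq: "tilde_mat A *\<^sub>v xn = tilde_mat A *\<^sub>v x" .
    have xc: "x \<in> carrier_vec n" using x by (simp add: face_def)
    have Axn: "A *\<^sub>v xn = A *\<^sub>v x" and "(\<Sum>i<n. xn $ i) = (\<Sum>i<n. x $ i)"
      using tilde_mat_mult_vec_eqD[OF A xnc xc eq] by auto
    \<comment> \<open>The set \<open>I\<close> is left open because the two outcomes below have
      different supports.\<close>
    then have face: "xn \<in> face n I" if "\<And>l. l < n \<Longrightarrow> l \<notin> I \<Longrightarrow> xn $ l = 0" for I
      using that xn0 xnc x by (auto simp: face_def)
    \<comment> \<open>As \<open>j\<close> is not in \<open>B\<close>, the entering index leaves at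
      once exactly when \<open>p = ?k\<close>.\<close>
    show ?thesis
    proof (cases "p = ?k")
      case True
      have "xn \<in> face n (set B)"
      proof (intro face)
        fix l assume "l < n" "l \<notin> set B"
        moreover have "xn $ j = 0" using xn_nth[OF p(1)] wp True by simp
        ultimately show "xn $ l = 0" using xn_out[of l] by (cases "l = j") auto
      qed
      then show ?thesis
        using out' True Axn B pinv by simp
    next
      case False
      then have pk: "p < ?k" using p by simp
      then have ne: "?Bj ! p \<noteq> j" using j by (auto simp: nth_append)
      have upd: "set (B[p := j]) = insert j (set B - {B ! p})"
        using pk B by (simp add: set_update_distinct)
      have "xn $ (B ! p) = 0" using xn_nth[OF p(1)] wp pk by (simp add: nth_append)
      then have "xn \<in> face n (set (B[p := j]))"
        using xn_out upd by (intro face) auto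
      \<comment> \<open>The pivot \<open>u' $ p\<close> is nonzero because the ratio test admits
        negative entries only.\<close>
      moreover have "pinv_of (?N (B[p := j])) (pinv_replace M u' p)"
        using pk p(2) ui[OF p(1)] N[of "B[p := j]"] dep A
        by (intro pinv_of_replace[OF N[of B] pinv a])
          (auto simp: u'_def mirr_coeffs_def)
      moreover have "x' = xn" "B' = B[p := j]" "M' = pinv_replace M u' p"
        using out' ne by simp_all
      moreover have "distinct (B[p := j])" "set (B[p := j]) \<subseteq> {..<n}"
        using B j upd by (auto intro!: distinct_list_update)
      ultimately show ?thesis
        using Axn by blast
    qed
  qed
qed

subsection \<open>The limited support scheme\<close>

lemma norm_convex_combination:
  fixes z q :: "real vec"
  assumes "z \<in> carrier_vec m" "q \<in> carrier_vec m" "y \<in> carrier_vec m"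
    and "\<And>i. i < m \<Longrightarrow> y $ i = (1 - \<theta>) * z $ i + \<theta> * q $ i"
  shows "y \<bullet> y = (1 - \<theta>)\<^sup>2 * (z \<bullet> z) + 2 * \<theta> * (1 - \<theta>) * (q \<bullet> z) + \<theta>\<^sup>2 * (q \<bullet> q)"
proof -
  have "y \<bullet> y = (\<Sum>i<m. ((1 - \<theta>) * z $ i + \<theta> * q $ i) * ((1 - \<theta>) * z $ i + \<theta> * q $ i))"
    using assms by (auto simp: scalar_prod_def lessThan_atLeast0 intro!: sum.cong)
  also have "\<dots> = (\<Sum>i<m. (1 - \<theta>)\<^sup>2 * (z $ i * z $ i) + 2 * \<theta> * (1 - \<theta>) * (q $ i * z $ i) + \<theta>\<^sup>2 * (q $ i * q $ i))"
    by (intro sum.cong refl) (simp add: power2_eq_square algebra_simps)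
  also have "\<dots> = (1 - \<theta>)\<^sup>2 * (z \<bullet> z) + 2 * \<theta> * (1 - \<theta>) * (q \<bullet> z) + \<theta>\<^sup>2 * (q \<bullet> q)"
    using assms by (simp add: scalar_prod_def lessThan_atLeast0 sum.distrib sum_distrib_left)
  finally show ?thesis .
qed

lemma scalar_prod_self_nonneg: "0 \<le> v \<bullet> v" for v :: "real vec"
  by (auto simp: scalar_prod_def intro!: sum_nonneg)

lemma euclid_norm_power2: "(euclid_norm v)\<^sup>2 = v \<bullet> v"
  by (simp add: euclid_norm_def scalar_prod_self_nonneg)

lemma euclid_norm_pos_part_le: "euclid_norm (pos_part v) \<le> euclid_norm v"
  unfolding euclid_norm_def pos_part_def
  by (intro real_sqrt_le_mono) (auto simp: scalar_prod_def max_def intro!: sum_mono)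

lemma inf_norm_ge: "i < dim_vec v \<Longrightarrow> \<bar>v $ i\<bar> \<le> inf_norm v"
  unfolding inf_norm_def by (intro Max_ge) auto

text \<open>Unit mass is spread over at most \<open>length B\<close> entries, none of them larger
  than the norm.\<close>

lemma face_inf_norm:
  assumes "x \<in> face n (set B)" "set B \<subseteq> {..<n}"
  shows "1 \<le> real (length B) * inf_norm x"
proof -
  have x: "dim_vec x = n" using assms by (auto simp: face_def)
  have "1 = (\<Sum>i<n. x $ i)" using assms by (simp add: face_def)
  also have "\<dots> = (\<Sum>i\<in>set B. x $ i)"
    using assms by (intro sum.mono_neutral_right) (auto simp: face_def)
  also have "\<dots> \<le> (\<Sum>i\<in>set B. inf_norm x)"
    using inf_norm_ge[of _ x] x assms(2) by (intro sum_mono) (auto intro: order_trans[OF abs_ge_self])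
  also have "\<dots> = real (card (set B)) * inf_norm x" by simp
  finally have *: "1 \<le> real (card (set B)) * inf_norm x" .
  then have "0 \<le> inf_norm x" by (smt (verit) mult_nonneg_nonpos of_nat_0_le_iff)
  then have "real (card (set B)) * inf_norm x \<le> real (length B) * inf_norm x"
    using card_length[of B] by (intro mult_right_mono) auto
  with * show ?thesis by simp
qed

lemma move_towards_nth:
  "j < dim_vec x \<Longrightarrow> i < dim_vec x \<Longrightarrow> move_towards x j \<theta> $ i = (1 - \<theta>) * x $ i + \<theta> * of_bool (i = j)"
  by (simp add: move_towards_def algebra_simps)

lemma move_towards_dim [simp]: "dim_vec (move_towards x j \<theta>) = dim_vec x"
  by (simp add: move_towards_def)

lemma move_towards_face:
  assumes x: "x \<in> face n I" and j: "j < n" and \<theta>: "0 \<le> \<theta>" "\<theta> \<le> 1"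
  shows "move_towards x j \<theta> \<in> face n (insert j I)"
proof -
  have d: "dim_vec x = n" using x by (auto simp: face_def)
  have nth: "move_towards x j \<theta> $ i = (1 - \<theta>) * x $ i + \<theta> * of_bool (i = j)" if "i < n" for i
    using that j d by (simp add: move_towards_nth)
  have "(\<Sum>i<n. move_towards x j \<theta> $ i) = (1 - \<theta>) * (\<Sum>i<n. x $ i) + (\<Sum>i<n. if i = j then \<theta> else 0)"
    unfolding sum_distrib_left sum.distrib[symmetric] by (intro sum.cong refl) (simp add: nth)
  also have "\<dots> = 1" using x j by (simp add: face_def)
  finally show ?thesis
    unfolding face_def using x \<theta> nth d by (auto simp: face_def intro: carrier_vecI)
qed

lemma stepsize_unit_interval: "lss_stepsize v Q t x j \<theta> \<Longrightarrow> 0 \<le> \<theta> \<and> \<theta> \<le> 1"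
  by (cases v) auto

text \<open>Orthonormality makes \<open>transpose_mat Q\<close> a left inverse of \<open>Q\<close>,
  and its product with \<open>Q\<close> in the other order is symmetric. So the general bounds on
  pseudoinverses apply to \<open>Q\<close> itself.\<close>

lemma orthonormal_basis_matrixD:
  assumes "orthonormal_basis_matrix n m L Q"
  shows "Q \<in> carrier_mat n m" "pinv_of Q (transpose_mat Q)"
proof -
  show Q: "Q \<in> carrier_mat n m"
    using assms by (simp add: orthonormal_basis_matrix_def Let_def)
  have "transpose_mat Q * Q = 1\<^sub>m m"
  proof (rule eq_matI)
    fix i j assume "i < dim_row (1\<^sub>m m :: real mat)" "j < dim_col (1\<^sub>m m :: real mat)"
    then have ij: "i < m" "j < m" by auto
    then have "(transpose_mat Q * Q) $$ (i, j) = col Q i \<bullet> col Q j"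
      using Q by (simp add: index_mult_mat(1))
    then show "(transpose_mat Q * Q) $$ (i, j) = 1\<^sub>m m $$ (i, j)"
      using assms ij by (simp add: orthonormal_basis_matrix_def Let_def)
  qed (use Q in auto)
  moreover have "transpose_mat (Q * transpose_mat Q) = Q * transpose_mat Q"
    using transpose_mult[of Q n m "transpose_mat Q" n] Q by simp
  ultimately show "pinv_of Q (transpose_mat Q)"
    using Q unfolding pinv_of_def by auto
qed

section \<open>The projection given by a fixed matrix with orthonormal columns\<close>

locale orthonormal_columns =
  fixes Q :: "real mat" and n m :: nat
  assumes Q: "Q \<in> carrier_mat n m" and pinv_transpose: "pinv_of Q (transpose_mat Q)"
begin

abbreviation "A \<equiv> transpose_mat Q"

lemma A: "A \<in> carrier_mat m n"
  using Q by simp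

lemma dim_Q [simp]: "dim_row Q = n" "dim_col Q = m"
  using Q by auto

lemma m_le_n: "m \<le> n"
  using pinv_of_dim_le[OF pinv_transpose] by simp

text \<open>The squared norm of row \<open>i\<close> is a diagonal entry of the projection.\<close>

lemma row_norm_le_1:
  assumes "i < n"
  shows "row Q i \<bullet> row Q i \<le> 1"
  using pinv_of_diag_le_1[OF pinv_transpose, of i] assms by (simp add: index_mult_mat(1))

lemma proj_mat_mult:
  assumes "x \<in> carrier_vec n"
  shows "proj_mat Q *\<^sub>v x = Q *\<^sub>v (A *\<^sub>v x)"
  unfolding proj_mat_def by (rule assoc_mult_mat_vec[OF Q A assms])

text \<open>\<open>Q\<close> is an isometry because \<open>A * Q\<close> is the identity. Thus the
  line search, stated for \<open>P x\<close>, minimises the norm of \<open>z\<close>.\<close>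

lemma proj_mat_norm:
  assumes x: "x \<in> carrier_vec n"
  shows "(proj_mat Q *\<^sub>v x) \<bullet> (proj_mat Q *\<^sub>v x) = (A *\<^sub>v x) \<bullet> (A *\<^sub>v x)"
proof -
  define z where "z = A *\<^sub>v x"
  have z: "z \<in> carrier_vec m" using mult_mat_vec_carrier[OF A x] by (simp add: z_def)
  have Qz: "Q *\<^sub>v z \<in> carrier_vec n" using mult_mat_vec_carrier[OF Q z] .
  have "(Q *\<^sub>v z) \<bullet> (Q *\<^sub>v z) = (A *\<^sub>v (Q *\<^sub>v z)) \<bullet> z"
    using transpose_vec_mult_scalar[OF Q z Qz] by simp
  also have "A *\<^sub>v (Q *\<^sub>v z) = (A * Q) *\<^sub>v z"
    by (rule assoc_mult_mat_vec[OF A Q z, symmetric])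
  also have "A * Q = 1\<^sub>m m"
    using pinv_transpose by (simp add: pinv_of_def)
  finally show ?thesis using z x by (simp add: proj_mat_mult z_def)
qed

lemma move_towards_image:
  assumes x: "x \<in> carrier_vec n" and j: "j < n" and i: "i < m"
  shows "(A *\<^sub>v move_towards x j \<theta>) $ i = (1 - \<theta>) * (A *\<^sub>v x) $ i + \<theta> * row Q j $ i"
proof -
  have x': "move_towards x j \<theta> \<in> carrier_vec n" using x by (intro carrier_vecI) simp
  have "(A *\<^sub>v move_towards x j \<theta>) $ i
      = (\<Sum>l<n. (1 - \<theta>) * (A $$ (i, l) * x $ l) + (if l = j then \<theta> * A $$ (i, l) else 0))"
    unfolding mult_mat_vec_index[OF A x' i]
    using x j by (intro sum.cong refl) (auto simp: move_towards_nth algebra_simps)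
  also have "\<dots> = (1 - \<theta>) * (A *\<^sub>v x) $ i + \<theta> * A $$ (i, j)"
    unfolding mult_mat_vec_index[OF A x i] using j
    by (simp add: sum.distrib sum_distrib_left)
  finally show ?thesis using i j by simp
qed

section \<open>The invariant of the iteration\<close>

text \<open>The last conjunct carries two facts: the stored matrix is the true pseudoinverse, and,
  having a left inverse, the lifted support columns are linearly independent.\<close>

definition valid_state :: "lss_state \<Rightarrow> bool" where
  "valid_state s \<longleftrightarrow> distinct (supp s) \<and> set (supp s) \<subseteq> {..<n} \<and>
     xvec s \<in> face n (set (supp s)) \<and> zvec s = A *\<^sub>v xvec s \<and>
     pinv_of (sub_cols (tilde_mat A) (supp s)) (pinv s)"

lemma valid_state_length: "valid_state s \<Longrightarrow> length (supp s) \<le> m + 1"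
  using pinv_of_dim_le[of "sub_cols (tilde_mat A) (supp s)" "pinv s"]
  by (simp add: valid_state_def)

lemma pinv_of_single_column:
  assumes j: "j < n"
  shows "pinv_of (sub_cols (tilde_mat A) [j])
    (mat_of_row ((1 / (col (tilde_mat A) j \<bullet> col (tilde_mat A) j)) \<cdot>\<^sub>v col (tilde_mat A) j))"
proof -
  define a where "a = col (tilde_mat A) j"
  define s where "s = 1 / (a \<bullet> a)"
  let ?N = "sub_cols (tilde_mat A) [j]" and ?M = "mat_of_row (s \<cdot>\<^sub>v a)"
  have a: "a \<in> carrier_vec (m + 1)" unfolding a_def by (intro carrier_vecI) simp
  have N: "?N \<in> carrier_mat (m + 1) 1" using sub_cols_carrier[of "tilde_mat A" "[j]"] by simp
  have M: "?M \<in> carrier_mat 1 (m + 1)" using a by simp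
  have Nl: "?N $$ (l, 0) = a $ l" if "l < m + 1" for l
    using that j by (simp add: sub_cols_index a_def)
  \<comment> \<open>The leading 1 of a lifted column excludes division by zero.\<close>
  have "a $ 0 = 1" using j by (simp add: a_def tilde_mat_def)
  then have "0 < a \<bullet> a"
    unfolding scalar_prod_def carrier_vecD[OF a] by (intro sum_pos2[of _ 0]) auto
  then have s: "s * (a \<bullet> a) = 1" by (simp add: s_def)
  have "?M * ?N = 1\<^sub>m 1"
  proof (rule eq_matI)
    fix i l assume "i < dim_row (1\<^sub>m 1 :: real mat)" "l < dim_col (1\<^sub>m 1 :: real mat)"
    then have il: "i = 0" "l = 0" by auto
    have "(?M * ?N) $$ (0, 0) = (\<Sum>r<m + 1. ?M $$ (0, r) * ?N $$ (r, 0))"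
      by (rule mult_mat_index[OF M N]) simp_all
    also have "\<dots> = (\<Sum>r<m + 1. s * (a $ r * a $ r))"
      using a Nl by (intro sum.cong refl) simp
    also have "\<dots> = 1"
      using s a by (simp add: scalar_prod_def lessThan_atLeast0 flip: sum_distrib_left)
    finally show "(?M * ?N) $$ (i, l) = 1\<^sub>m 1 $$ (i, l)" by (simp add: il)
  qed (use M N in auto)
  moreover have "transpose_mat (?N * ?M) = ?N * ?M"
  proof (rule eq_matI)
    have NM: "(?N * ?M) $$ (i, l) = s * a $ i * a $ l" if "i < m + 1" "l < m + 1" for i l
      unfolding mult_mat_index[OF N M that] using that a Nl by simp
    fix i l assume "i < dim_row (?N * ?M)" "l < dim_col (?N * ?M)"
    then have "i < m + 1" "l < m + 1" using a by auto
    then show "transpose_mat (?N * ?M) $$ (i, l) = (?N * ?M) $$ (i, l)"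
      using index_transpose_mat(1)[of i "?N * ?M" l] a NM[of i l] NM[of l i] by simp
  qed (use a in auto)
  ultimately show ?thesis
    using M N unfolding pinv_of_def by (simp add: s_def a_def)
qed

lemma valid_state_init:
  assumes "n \<ge> 1"
  shows "valid_state (lss_init Q)"
proof -
  have "(\<Sum>i<n. unit_vec n 0 $ i) = (\<Sum>i<n. if i = 0 then 1 else (0 :: real))"
    by (intro sum.cong refl) simp
  then have "unit_vec n 0 \<in> face n {0}"
    using assms by (auto simp: face_def)
  then show ?thesis
    using assms pinv_of_single_column[of 0]
    by (auto simp: valid_state_def lss_init_def Let_def)
qed

text \<open>\<open>zvec s'\<close> is formed from the point before the reduction; it fits the
  reduced point because \<open>mirr_correct\<close> preserves the image under \<open>A\<close>. The
  step size is exported for the norm estimate.\<close>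

lemma valid_state_step:
  assumes s: "valid_state s" and step: "lss_step v Q t s j s'"
  obtains \<theta> where "valid_state s'" "lss_stepsize v Q t (xvec s) j \<theta>"
    "zvec s' = A *\<^sub>v move_towards (xvec s) j \<theta>"
proof -
  obtain \<theta> where \<theta>: "lss_stepsize v Q t (xvec s) j \<theta>"
    and z: "zvec s' = A *\<^sub>v move_towards (xvec s) j \<theta>"
    and out: "(xvec s', supp s', pinv s') =
      (if j \<notin> set (supp s) then mirr A (supp s) (pinv s) j (move_towards (xvec s) j \<theta>)
       else (move_towards (xvec s) j \<theta>, supp s, pinv s))"
    using step by (auto simp: lss_step_def Let_def)
  have j: "j < n" using step by (simp add: lss_step_def)
  have x': "move_towards (xvec s) j \<theta> \<in> face n (insert j (set (supp s)))"
    using s stepsize_unit_interval[OF \<theta>] j by (intro move_towards_face) (auto simp: valid_state_def)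
  have "valid_state s'"
  proof (cases "j \<in> set (supp s)")
    case True
    then have "insert j (set (supp s)) = set (supp s)" by auto
    then show ?thesis using True s out x' z by (simp add: valid_state_def)
  next
    case False
    then have "mirr A (supp s) (pinv s) j (move_towards (xvec s) j \<theta>) = (xvec s', supp s', pinv s')"
      using out by simp
    from mirr_correct[OF A _ _ j False _ x' this] show ?thesis
      using s z by (simp add: valid_state_def)
  qed
  with \<theta> z that show thesis by blast
qed

section \<open>Decay of the norm\<close>

text \<open>The step size \<open>1 / (t + 1)\<close> is feasible for the line search, so the perceptron estimate
  bounds both variants.\<close>

lemma norm_step:
  assumes s: "valid_state s" and step: "lss_step v Q t s j s'" and running: "\<not> lss_stop Q s"
    and IH: "real t * (zvec s \<bullet> zvec s) \<le> 1"
  shows "real (Suc t) * (zvec s' \<bullet> zvec s') \<le> 1"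
proof -
  define x z q where "x = xvec s" and "z = zvec s" and "q = row Q j"
  have x: "x \<in> carrier_vec n" using s by (simp add: valid_state_def face_def x_def)
  have zx: "z = A *\<^sub>v x" using s by (simp add: valid_state_def z_def x_def)
  have z: "z \<in> carrier_vec m" using mult_mat_vec_carrier[OF A x] by (simp add: zx)
  have j: "j < n" and jmin: "\<And>i. i < n \<Longrightarrow> q \<bullet> z \<le> row Q i \<bullet> z"
    using step by (simp_all add: lss_step_def q_def z_def)
  have q: "q \<in> carrier_vec m" using j by (intro carrier_vecI) (simp add: q_def)
  obtain \<theta> where \<theta>: "lss_stepsize v Q t x j \<theta>" and z': "zvec s' = A *\<^sub>v move_towards x j \<theta>"
    using valid_state_step[OF s step] unfolding x_def by blast
  define f where "f = (\<lambda>\<eta>. (A *\<^sub>v move_towards x j \<eta>) \<bullet> (A *\<^sub>v move_towards x j \<eta>))"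
  have mc: "move_towards x j \<eta> \<in> carrier_vec n" for \<eta> using x by (intro carrier_vecI) simp
  \<comment> \<open>A step towards vertex \<open>j\<close> moves the image towards \<open>q\<close>,
    so \<open>f\<close> is an explicit quadratic.\<close>
  have f: "f \<eta> = (1 - \<eta>)\<^sup>2 * (z \<bullet> z) + 2 * \<eta> * (1 - \<eta>) * (q \<bullet> z) + \<eta>\<^sup>2 * (q \<bullet> q)" for \<eta>
    unfolding f_def using move_towards_image[OF x j] zx
    by (intro norm_convex_combination[OF z q mult_mat_vec_carrier[OF A mc]]) (simp add: q_def)
  \<comment> \<open>The first alternative of the stopping condition fails, so some entry
    \<open>row Q i \<bullet> z\<close> of \<open>P x\<close> is nonpositive; minimality at
    \<open>j\<close> transfers this to \<open>q \<bullet> z\<close>.\<close>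
  have "\<exists>i<n. (proj_mat Q *\<^sub>v x) $ i \<le> 0"
    using running by (auto simp: lss_stop_def x_def not_less)
  then obtain i where "i < n" "row Q i \<bullet> z \<le> 0"
    using x by (auto simp: proj_mat_mult zx index_mult_mat_vec)
  then have qz: "q \<bullet> z \<le> 0" using jmin by (meson order_trans)
  have qq: "q \<bullet> q \<le> 1" using row_norm_le_1[OF j] by (simp add: q_def)
  define \<eta> :: real where "\<eta> = 1 / (real t + 1)"
  have \<eta>: "0 \<le> \<eta>" "\<eta> \<le> 1" "(real t + 1) * \<eta> = 1" "(real t + 1) * (1 - \<eta>) = real t"
    by (auto simp: \<eta>_def field_simps)
  have "f \<theta> \<le> f \<eta>"
  proof (cases v)
    case LSP
    then show ?thesis using \<theta> by (simp add: \<eta>_def)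
  next
    case LSVN
    then show ?thesis
      using \<theta> \<eta> by (simp add: euclid_norm_power2 proj_mat_norm[OF mc] f_def)
  qed
  \<comment> \<open>Scaling by the square of \<open>t + 1\<close> clears all fractions; the right
    side is then at most \<open>t + 1\<close>, and one such factor cancels.\<close>
  then have "(real t + 1)\<^sup>2 * f \<theta> \<le> (real t + 1)\<^sup>2 * f \<eta>"
    by (intro mult_left_mono) auto
  also have "\<dots> = ((real t + 1) * (1 - \<eta>))\<^sup>2 * (z \<bullet> z)
      + 2 * ((real t + 1) * \<eta>) * ((real t + 1) * (1 - \<eta>)) * (q \<bullet> z) + ((real t + 1) * \<eta>)\<^sup>2 * (q \<bullet> q)"
    by (simp add: f power2_eq_square algebra_simps)
  also have "\<dots> = real t * (real t * (z \<bullet> z)) + 2 * (real t * (q \<bullet> z)) + q \<bullet> q"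
    by (simp add: \<eta> power2_eq_square)
  also have "\<dots> \<le> real t * 1 + 0 + 1"
    using IH qz qq
    by (intro add_mono mult_left_mono) (auto simp: z_def mult_nonneg_nonpos)
  finally have "(real t + 1) * ((real t + 1) * f \<theta>) \<le> (real t + 1) * 1"
    by (simp add: power2_eq_square algebra_simps)
  then have "(real t + 1) * f \<theta> \<le> 1"
    by (subst (asm) mult_le_cancel_left_pos) auto
  then show ?thesis by (simp add: z' f_def add.commute)
qed

text \<open>The norm bound is multiplied out so that \<open>t = 0\<close> is trivial. Only the
  states before \<open>t\<close> must be running, so the first stopping state is covered
  too.\<close>

lemma execution_invariant:
  assumes "n \<ge> 1" "lss_execution v Q S J" "\<forall>s<t. \<not> lss_stop Q (S s)"
  shows "valid_state (S t) \<and> real t * (zvec (S t) \<bullet> zvec (S t)) \<le> 1"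
  using assms(3)
proof (induction t)
  case 0
  then show ?case using assms valid_state_init by (simp add: lss_execution_def)
next
  case (Suc t)
  then have IH: "valid_state (S t)" "real t * (zvec (S t) \<bullet> zvec (S t)) \<le> 1" by auto
  have step: "lss_step v Q t (S t) (J t) (S (Suc t))"
    using assms(2) Suc.prems by (auto simp: lss_execution_def)
  show ?case
    using valid_state_step[OF IH(1) step] norm_step[OF IH(1) step _ IH(2)] Suc.prems by blast
qed

section \<open>Bound on the number of iterations\<close>

text \<open>The number 1 separates the two sides: \<open>3 * (m + 1) * sqrt n\<close> times the norm
  of \<open>z\<close> is at most 1, while \<open>m + 1\<close> times the maximum norm of
  \<open>x\<close> is at least 1.\<close>

lemma stop_if_norm_small:
  assumes n: "n \<ge> 1" and s: "valid_state s"
    and z: "real (9 * (m + 1)\<^sup>2 * n) * (zvec s \<bullet> zvec s) \<le> 1"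
  shows "lss_stop Q s"
proof -
  have x: "xvec s \<in> carrier_vec n" using s by (simp add: valid_state_def face_def)
  let ?c = "3 * sqrt (real n)"
  have "euclid_norm (pos_part (proj_mat Q *\<^sub>v xvec s)) \<le> euclid_norm (zvec s)"
    using euclid_norm_pos_part_le[of "proj_mat Q *\<^sub>v xvec s"] proj_mat_norm[OF x] s
    by (simp add: euclid_norm_def valid_state_def)
  moreover have "euclid_norm (zvec s) \<le> 1 / ?c * inf_norm (xvec s)"
  proof -
    define d where "d = real (m + 1)"
    have "9 * d\<^sup>2 * real n * (zvec s \<bullet> zvec s) \<le> 1"
      using z by (simp only: d_def of_nat_mult of_nat_power of_nat_numeral)
    \<comment> \<open>The square of \<open>d * ?c\<close> is \<open>9 * d\<^sup>2 * n\<close>, the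
      source of the iteration bound.\<close>
    then have "(d * ?c * euclid_norm (zvec s))\<^sup>2 \<le> 1\<^sup>2"
      by (simp add: power_mult_distrib euclid_norm_power2 mult_ac)
    then have "d * ?c * euclid_norm (zvec s) \<le> 1"
      using power2_le_imp_le zero_le_one by blast
    also have "1 \<le> real (length (supp s)) * inf_norm (xvec s)"
      using s by (intro face_inf_norm) (auto simp: valid_state_def)
    also have "\<dots> \<le> d * inf_norm (xvec s)"
    proof (rule mult_right_mono)
      show "0 \<le> inf_norm (xvec s)"
        using inf_norm_ge[of 0 "xvec s"] x n by (simp add: order_trans[OF abs_ge_zero])
    qed (use valid_state_length[OF s] in \<open>simp add: d_def\<close>)
    finally have "d * (?c * euclid_norm (zvec s)) \<le> d * inf_norm (xvec s)"
      by (simp only: mult.assoc)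
    then have "?c * euclid_norm (zvec s) \<le> inf_norm (xvec s)"
      by (subst (asm) mult_le_cancel_left_pos) (auto simp: d_def)
    then show ?thesis using n by (simp add: field_simps)
  qed
  ultimately show ?thesis by (simp add: lss_stop_def)
qed

lemma execution_stops:
  assumes n: "n \<ge> 1" and exec: "lss_execution v Q S J"
  shows "\<exists>t\<le>9 * (m + 1)\<^sup>2 * n. lss_stop Q (S t)"
proof (rule ccontr)
  let ?T = "9 * (m + 1)\<^sup>2 * n"
  assume running: "\<not> ?thesis"
  then have "\<forall>s<?T. \<not> lss_stop Q (S s)" by auto
  then have "lss_stop Q (S ?T)"
    using execution_invariant[OF n exec] stop_if_norm_small[OF n] by blast
  with running show False by blast
qed

section \<open>Operation counts\<close>

text \<open>The support has at most \<open>m + 1 \<le> 2 * m\<close> elements, so the matrices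
  involved have O(\<open>m * m\<close>) entries and nothing depends on \<open>n\<close>. The
  constant is 8 + 9 + 6 + 81, for the step size, the entries of \<open>x'\<close>, its image and the
  reduction.\<close>

lemma update_ops_le:
  assumes m: "m \<ge> 1" and s: "valid_state s"
  shows "update_ops v Q s j \<le> 104 * m\<^sup>2"
proof -
  define k M where "k = length (supp s)" and "M = m * m"
  have k: "k \<le> 2 * m" "m + 1 \<le> 2 * m" "k + 1 \<le> 3 * m"
    using valid_state_length[OF s] m by (auto simp: k_def)
  have M: "m \<le> M" using m by (auto simp: M_def)
  have kd: "k * (m + 1) \<le> 4 * M" and kd1: "(k + 1) * (m + 1) \<le> 6 * M" and mk: "m * (k + 1) \<le> 3 * M"
    using mult_le_mono[OF k(1,2)] mult_le_mono[OF k(3,2)] mult_le_mono[OF le_refl k(3), of m]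
    by (simp_all add: M_def)
  have mv: "matvec_ops k (m + 1) \<le> 8 * M" "matvec_ops (m + 1) k \<le> 8 * M" "matvec_ops m (k + 1) \<le> 6 * M"
    using kd mk by (simp_all add: matvec_ops_def dot_ops_def mult_ac)
  have "stepsize_ops v m \<le> 8 * M"
    using M m by (cases v) (auto simp: dot_ops_def)
  moreover have "3 * (k + 1) \<le> 9 * M" using k M by simp
  \<comment> \<open>Coefficients and independence test cost at most \<open>18 * M\<close>; 81 = 18 +
    36 + 27 covers both branches, although only one is executed.\<close>
  moreover have "mirr_ops A (supp s) (pinv s) j \<le> 81 * M"
  proof -
    have d: "m + 1 \<le> 2 * M" using k M by simp
    have "pinv_append_ops (m + 1) k \<le> 36 * M"
      unfolding pinv_append_ops_def dot_ops_def using mv d kd1 by simp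
    moreover have "3 * (k + 1) + 2 * (k + 1) + pinv_replace_ops (m + 1) k \<le> 27 * M"
      unfolding pinv_replace_ops_def using k M kd by simp
    ultimately show ?thesis
      unfolding mirr_ops_def Let_def k_def[symmetric] index_transpose_mat dim_Q
      using mv d by (simp split: if_split del: One_nat_def)
  qed
  ultimately have "update_ops v Q s j \<le> 104 * M"
    unfolding update_ops_def Let_def dim_Q k_def[symmetric] using mv(3) by (simp split: if_split)
  then show ?thesis by (simp add: M_def power2_eq_square)
qed

text \<open>The lower-order terms are absorbed since \<open>m\<close> and \<open>n\<close> are at
  least 1, giving 2 + 4 + 2 + 6 = 14.\<close>

lemma search_ops_le:
  assumes m: "m \<ge> 1" and s: "valid_state s"
  shows "search_ops Q s \<le> 14 * (m * n)"
proof -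
  have n: "1 \<le> n" using m m_le_n by simp
  have "n \<le> m * n" "m \<le> m * n" using m n by auto
  moreover have "n * (2 * m) = 2 * (m * n)" by simp
  ultimately show ?thesis
    unfolding search_ops_def matvec_ops_def dot_ops_def dim_Q
    using valid_state_length[OF s] m by linarith
qed

text \<open>O(\<open>m\<^sup>2 * n\<close>) iterations with O(\<open>m\<^sup>2\<close>) update work
  each give the first bound. The stopping test and the choice of \<open>j\<close> read all
  \<open>n\<close> rows, O(\<open>m * n\<close>) per iteration, whence the second;
  \<open>m \<le> n\<close> lets it absorb the first.\<close>

lemma ops_le:
  assumes m: "m \<ge> 1" and exec: "lss_execution v Q S J" and running: "\<forall>s<T. \<not> lss_stop Q (S s)"
  shows "lss_update_ops v Q S J T \<le> 4268 * (m ^ 4 * n)"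
    and "lss_total_ops v Q S J T \<le> 4268 * (m ^ 3 * n\<^sup>2)"
proof -
  have n: "1 \<le> n" using m m_le_n by simp
  have valid: "valid_state (S t)" if "t \<le> T" for t
    using execution_invariant[OF n exec, of t] running that by auto
  obtain t where "t \<le> 9 * (m + 1)\<^sup>2 * n" "lss_stop Q (S t)"
    using execution_stops[OF n exec] by blast
  then have "T \<le> 9 * (m + 1)\<^sup>2 * n"
    using running by (metis le_trans not_le_imp_less)
  also have "\<dots> \<le> 9 * (2 * m)\<^sup>2 * n"
    using m by (intro mult_le_mono power_mono) auto
  finally have T: "T \<le> 36 * (m\<^sup>2 * n)" by (simp add: power_mult_distrib)
  have upd: "lss_update_ops v Q S J T \<le> 3750 * (m ^ 4 * n)"
  proof -
    have "(\<Sum>t<T. update_ops v Q (S t) (J t)) \<le> (\<Sum>t<T. 104 * m\<^sup>2)"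
      using valid by (intro sum_mono update_ops_le[OF m]) auto
    also have "\<dots> = T * (104 * m\<^sup>2)" by simp
    also have "\<dots> \<le> 36 * (m\<^sup>2 * n) * (104 * m\<^sup>2)" using T by (rule mult_le_mono1)
    also have "\<dots> = 3744 * (m ^ 4 * n)" by (simp add: power2_eq_square power4_eq_xxxx)
    finally have sum: "(\<Sum>t<T. update_ops v Q (S t) (J t)) \<le> 3744 * (m ^ 4 * n)" .
    \<comment> \<open>Initialization is linear in \<open>m\<close>; its share 6 raises 36 * 104 =
      3744 to 3750.\<close>
    have "m * 1 \<le> m ^ 4 * n" using m n by (intro mult_le_mono) (auto intro: self_le_power)
    then have "init_ops m \<le> 6 * (m ^ 4 * n)" using m by (simp add: init_ops_def dot_ops_def)
    then show ?thesis using sum by (simp add: lss_update_ops_def)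
  qed
  \<comment> \<open>4268 = 3750 + 518, with 518 coming from the search work, serves as a common
    constant for both bounds.\<close>
  then show "lss_update_ops v Q S J T \<le> 4268 * (m ^ 4 * n)" by linarith
  have "m ^ 4 * n = m ^ 3 * n * m" by (simp add: power4_eq_xxxx power3_eq_cube)
  also have "\<dots> \<le> m ^ 3 * n * n" using m_le_n by (rule mult_le_mono2)
  finally have 43: "m ^ 4 * n \<le> m ^ 3 * n\<^sup>2" by (simp add: power2_eq_square mult.assoc)
  have "(\<Sum>t\<le>T. search_ops Q (S t)) \<le> (\<Sum>t\<le>T. 14 * (m * n))"
    using valid by (intro sum_mono search_ops_le[OF m]) auto
  also have "\<dots> = (T + 1) * (14 * (m * n))" by simp
  \<comment> \<open>The stopping test runs once more than the iteration, hence 37 instead of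
    36.\<close>
  also have "\<dots> \<le> (37 * (m\<^sup>2 * n)) * (14 * (m * n))"
  proof (rule mult_le_mono1)
    have "1 \<le> m\<^sup>2 * n" using m n by simp
    then show "T + 1 \<le> 37 * (m\<^sup>2 * n)" using T by linarith
  qed
  also have "\<dots> = 518 * (m ^ 3 * n\<^sup>2)" by (simp add: power2_eq_square power3_eq_cube)
  finally show "lss_total_ops v Q S J T \<le> 4268 * (m ^ 3 * n\<^sup>2)"
    unfolding lss_total_ops_def using upd 43 by linarith
qed

end

theorem proposition1:
  shows "(\<forall>v n m L Q S J.
            n \<ge> 1 \<and> orthonormal_basis_matrix n m L Q \<and> lss_execution v Q S J \<longrightarrow>
            (\<forall>t\<ge>1. (\<forall>s<t. \<not> lss_stop Q (S s)) \<longrightarrow>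
                 (euclid_norm (zvec (S t)))\<^sup>2 \<le> 1 / real t) \<and>
            (\<exists>t\<le>9 * (m + 1)\<^sup>2 * n. lss_stop Q (S t))) \<and>
         (\<exists>C::nat. \<forall>v n m L Q S J T.
            m \<ge> 1 \<and> orthonormal_basis_matrix n m L Q \<and> lss_execution v Q S J \<and>
            (\<forall>s<T. \<not> lss_stop Q (S s)) \<longrightarrow>
            lss_update_ops v Q S J T \<le> C * (m ^ 4 * n) \<and>
            lss_total_ops v Q S J T \<le> C * (m ^ 3 * n\<^sup>2))"
proof (rule conjI)
  show "\<forall>v n m L Q S J.
      n \<ge> 1 \<and> orthonormal_basis_matrix n m L Q \<and> lss_execution v Q S J \<longrightarrow>
      (\<forall>t\<ge>1. (\<forall>s<t. \<not> lss_stop Q (S s)) \<longrightarrow> (euclid_norm (zvec (S t)))\<^sup>2 \<le> 1 / real t) \<and>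
      (\<exists>t\<le>9 * (m + 1)\<^sup>2 * n. lss_stop Q (S t))"
  proof (intro allI impI, elim conjE)
    fix v n m L Q S J
    assume n: "n \<ge> 1" and L: "orthonormal_basis_matrix n m L Q" and exec: "lss_execution v Q S J"
    interpret orthonormal_columns Q n m
      using orthonormal_basis_matrixD[OF L] by unfold_locales
    have "(euclid_norm (zvec (S t)))\<^sup>2 \<le> 1 / real t"
      if "1 \<le> t" "\<forall>s<t. \<not> lss_stop Q (S s)" for t
      using execution_invariant[OF n exec that(2)] that(1)
      by (simp add: euclid_norm_power2 field_simps)
    then show "(\<forall>t\<ge>1. (\<forall>s<t. \<not> lss_stop Q (S s)) \<longrightarrow> (euclid_norm (zvec (S t)))\<^sup>2 \<le> 1 / real t) \<and>
        (\<exists>t\<le>9 * (m + 1)\<^sup>2 * n. lss_stop Q (S t))"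
      using execution_stops[OF n exec] by blast
  qed
  show "\<exists>C::nat. \<forall>v n m L Q S J T.
      m \<ge> 1 \<and> orthonormal_basis_matrix n m L Q \<and> lss_execution v Q S J \<and>
      (\<forall>s<T. \<not> lss_stop Q (S s)) \<longrightarrow>
      lss_update_ops v Q S J T \<le> C * (m ^ 4 * n) \<and>
      lss_total_ops v Q S J T \<le> C * (m ^ 3 * n\<^sup>2)"
  proof (intro exI[of _ 4268] allI impI, elim conjE)
    fix v n m L Q S J T
    assume m: "m \<ge> 1" and L: "orthonormal_basis_matrix n m L Q" and exec: "lss_execution v Q S J"
      and T: "\<forall>s<T. \<not> lss_stop Q (S s)"
    interpret orthonormal_columns Q n m
      using orthonormal_basis_matrixD[OF L] by unfold_locales
    show "lss_update_ops v Q S J T \<le> 4268 * (m ^ 4 * n) \<and>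
        lss_total_ops v Q S J T \<le> 4268 * (m ^ 3 * n\<^sup>2)"
      using ops_le[OF m exec T] by blast
  qed
qed

end
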